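(* Let $(M,g)$ be an $n$-dimensional $(N(k),\xi)$-semi-Riemannian manifold, let $a_0,\dots,a_7$ be real numbers, and suppose $M$ is $\mathcal{T}_a$-pseudosymmetric, i.e. $R\cdot\mathcal{T}_a=L_g\,Q(g,\mathcal{T}_a)$ holds on $\mathcal{U}_g=\{x\in M:(\mathcal{T}_a)_x\neq 0\}$ for some smooth function $L_g$ on $\mathcal{U}_g$. Then (on $\mathcal{U}_g$), for all vector fields $U,V,W,X$: \begin{align*} &\varepsilon a_0kR(U,V,W,X)+\varepsilon ka_4S(X,U)g(V,W)+\varepsilon ka_5S(X,V)g(U,W)+\varepsilon ka_6S(X,W)g(U,V)\\ &-\varepsilon k^2(n-1)a_6\,g(X,W)g(U,V)-\varepsilon k(ka_0+k(n-1)a_4)g(V,W)g(X,U)\\ &-\varepsilon k(-ka_0+k(n-1)a_5)g(U,W)g(X,V)-k^2(n-1)(a_2+a_3)g(X,U)\eta(V)\eta(W)\\ &-k^2(n-1)(a_1+a_3)g(X,V)\eta(U)\eta(W)-k^2(n-1)(a_1+a_2)g(X,W)\eta(U)\eta(V)\\ &+k(a_2+a_3)S(X,U)\eta(V)\eta(W)+k(a_1+a_3)S(X,V)\eta(U)\eta(W)+k(a_1+a_2)S(X,W)\eta(U)\eta(V)\\ =\;&L_g\Big(\varepsilon a_0R(U,V,W,X)+\varepsilon a_4S(X,U)g(V,W)+\varepsilon a_5S(X,V)g(U,W)+\varepsilon a_6S(X,W)g(U,V)\\ &-\varepsilon k(n-1)a_6\,g(U,V)g(X,W)-k(n-1)(a_2+a_3)g(X,U)\eta(V)\eta(W)\\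 &-k(n-1)(a_1+a_3)g(X,V)\eta(U)\eta(W)-k(n-1)(a_1+a_2)g(X,W)\eta(U)\eta(V)\\ &+(a_2+a_3)S(X,U)\eta(V)\eta(W)+(a_1+a_3)S(X,V)\eta(U)\eta(W)+(a_1+a_2)S(X,W)\eta(U)\eta(V)\\ &-\varepsilon(-ka_0+k(n-1)a_5)g(U,W)g(X,V)-\varepsilon(ka_0+k(n-1)a_4)g(V,W)g(X,U)\Big). \end{align*}
   Context: $(M,g)$ is an $n$-dimensional semi-Riemannian manifold; $R$ is its curvature tensor (sign convention: constant curvature $c$ means $R(X,Y)Z=c(g(Y,Z)X-g(X,Z)Y)$), $R(X,Y,Z,V)=g(R(X,Y)Z,V)$, $S(Y,Z)=\mathrm{tr}(X\mapsto R(X,Y)Z)$ the Ricci tensor, $Q$ the Ricci operator ($g(QX,Y)=S(X,Y)$), $r$ the scalar curvature. $(N(k),\xi)$-semi-Riemannian manifold: $k$ is a real number and $\xi$ is a vector field with $g(\xi,\xi)=\varepsilon\in\{1,-1\}$ lying in the $k$-nullity distribution, i.e. $R(X,Y)\xi=k(g(Y,\xi)X-g(X,\xi)Y)$ for all $X,Y$; $\eta(X)=\varepsilon g(X,\xi)$. For real $a_0,\dots,a_7$, $\mathcal{T}_a(X,Y)Z=a_0R(X,Y)Z+a_1S(Y,Z)X+a_2S(X,Z)Y+a_3S(X,Y)Z+a_4g(Y,Z)QX+a_5g(X,Z)QY+a_6g(X,Y)QZ+a_7r(g(Y,Z)X-g(X,Z)Y)$. For an endomorphism $F$: $(F\cdot\mathcal{T}_a)(U,V)W=F(\mathcal{T}_a(U,V)W)-\mathcal{T}_a(FU,V)W-\mathcal{T}_a(U,FV)W-\mathcal{T}_a(U,V)FW$.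 $R\cdot\mathcal{T}_a$ is the tensor $(U,V,W;Z,X)\mapsto(R(Z,X)\cdot\mathcal{T}_a)(U,V)W$, and $Q(g,\mathcal{T}_a)(U,V,W;Z,X)=((Z\wedge_g X)\cdot\mathcal{T}_a)(U,V)W$ with $(Z\wedge_g X)Y=g(X,Y)Z-g(Z,Y)X$. *)

theory Defs
  imports "HOL-Analysis.Analysis"
begin

section \<open>Smooth maps between normed spaces\<close>

text \<open>Meant for open \<open>S\<close> and a finite-dimensional domain.\<close>

primrec Ck_on :: "nat \<Rightarrow> ('a::real_normed_vector \<Rightarrow> 'b::real_normed_vector) \<Rightarrow> 'a set \<Rightarrow> bool"
where
  "Ck_on 0 f S \<longleftrightarrow> continuous_on S f"
| "Ck_on (Suc k) f S \<longleftrightarrow>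
     (\<forall>x\<in>S. f differentiable (at x)) \<and> (\<forall>v. Ck_on k (\<lambda>x. frechet_derivative f (at x) v) S)"

definition smooth_on :: "'a::real_normed_vector set \<Rightarrow> ('a \<Rightarrow> 'b::real_normed_vector) \<Rightarrow> bool"
  where "smooth_on S f \<longleftrightarrow> (\<forall>k. Ck_on k f S)"


section \<open>Smooth manifolds\<close>

text \<open>A chart is a pair (domain, coordinate map). The dimension of the manifold is \<open>CARD('n)\<close>.\<close>

type_synonym ('m, 'n) chart = "'m set \<times> ('m \<Rightarrow> real^'n)"

abbreviation chart_inv :: "('m, 'n::finite) chart \<Rightarrow> real^'n \<Rightarrow> 'm"
  where "chart_inv c \<equiv> inv_into (fst c) (snd c)"

text \<open>A tangent vector is a functional on real functions; a vector field assigns one to each point.\<close>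

type_synonym 'm tvec = "('m \<Rightarrow> real) \<Rightarrow> real"
type_synonym 'm vfield = "'m \<Rightarrow> 'm tvec"

record ('m, 'n::finite) manifold =
  top_of :: "'m topology"
  atlas :: "('m, 'n) chart set"

record ('m, 'n::finite) sr_manifold = "('m, 'n) manifold" +
  metric_tensor :: "'m \<Rightarrow> 'm tvec \<Rightarrow> 'm tvec \<Rightarrow> real"

definition is_chart :: "'m topology \<Rightarrow> ('m, 'n::finite) chart \<Rightarrow> bool"
  where "is_chart T c \<longleftrightarrow>
    openin T (fst c) \<and> open (snd c ` fst c) \<and>
    homeomorphic_map (subtopology T (fst c)) (top_of_set (snd c ` fst c)) (snd c)"

text \<open>The atlas is not required to be maximal.\<close>

definition smooth_manifold :: "('m, 'n::finite, 'z) manifold_scheme \<Rightarrow> bool"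
  where "smooth_manifold M \<longleftrightarrow>
    Hausdorff_space (top_of M) \<and> second_countable (top_of M) \<and>
    (\<forall>c\<in>atlas M. is_chart (top_of M) c) \<and>
    (\<Union>c\<in>atlas M. fst c) = topspace (top_of M) \<and>
    (\<forall>c\<in>atlas M. \<forall>d\<in>atlas M. smooth_on (snd c ` (fst c \<inter> fst d)) (snd d \<circ> chart_inv c))"

definition smooth_fun :: "('m, 'n::finite, 'z) manifold_scheme \<Rightarrow> 'm set \<Rightarrow> ('m \<Rightarrow> real) \<Rightarrow> bool"
  where "smooth_fun M W f \<longleftrightarrow> (\<forall>c\<in>atlas M. smooth_on (snd c ` (fst c \<inter> W)) (f \<circ> chart_inv c))"

definition smooth_near :: "('m, 'n::finite, 'z) manifold_scheme \<Rightarrow> 'm \<Rightarrow> ('m \<Rightarrow> real) \<Rightarrow> bool"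
  where "smooth_near M p f \<longleftrightarrow> (\<exists>W. openin (top_of M) W \<and> p \<in> W \<and> smooth_fun M W f)"

text \<open>The tangent vector at \<open>p\<close> with coordinate vector \<open>w\<close> in the chart \<open>c\<close>: the derivative in
  direction \<open>w\<close> of the coordinate expression of a function. All tangent vectors are normalised to
  take the value 0 on functions that are not smooth near \<open>p\<close>, so that two of them are equal as
  HOL functions iff they agree as derivations on germs at \<open>p\<close>.\<close>

definition coord_vec ::
    "('m, 'n::finite, 'z) manifold_scheme \<Rightarrow> ('m, 'n) chart \<Rightarrow> 'm \<Rightarrow> real^'n \<Rightarrow> 'm tvec"
  where "coord_vec M c p w =
    (\<lambda>f. if smooth_near M p f then frechet_derivative (f \<circ> chart_inv c) (at (snd c p)) w else 0)"

definition tangent :: "('m, 'n::finite, 'z) manifold_scheme \<Rightarrow> 'm \<Rightarrow> 'm tvec set"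
  where "tangent M p = {coord_vec M c p w | c w. c \<in> atlas M \<and> p \<in> fst c}"

definition components :: "('m, 'n::finite) chart \<Rightarrow> 'm tvec \<Rightarrow> real^'n"
  where "components c v = (\<chi> i. v (\<lambda>q. snd c q $ i))"

definition smooth_vfield :: "('m, 'n::finite, 'z) manifold_scheme \<Rightarrow> 'm set \<Rightarrow> 'm vfield \<Rightarrow> bool"
  where "smooth_vfield M W X \<longleftrightarrow>
    (\<forall>p\<in>W. X p \<in> tangent M p) \<and>
    (\<forall>W' f. openin (top_of M) W' \<and> W' \<subseteq> W \<and> smooth_fun M W' f \<longrightarrow> smooth_fun M W' (\<lambda>q. X q f))"

definition lie_bracket ::
    "('m, 'n::finite, 'z) manifold_scheme \<Rightarrow> 'm vfield \<Rightarrow> 'm vfield \<Rightarrow> 'm vfield"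
  where "lie_bracket M X Y p =
    (\<lambda>f. if smooth_near M p f then X p (\<lambda>q. Y q f) - Y p (\<lambda>q. X q f) else 0)"

definition chart_at :: "('m, 'n::finite, 'z) manifold_scheme \<Rightarrow> 'm \<Rightarrow> ('m, 'n) chart"
  where "chart_at M p = (SOME c. c \<in> atlas M \<and> p \<in> fst c)"

text \<open>Trace of an endomorphism of the tangent space at \<open>p\<close>, computed in the coordinate basis of
  some chart around \<open>p\<close> (the value does not depend on the chart).\<close>

definition tangent_trace ::
    "('m, 'n::finite, 'z) manifold_scheme \<Rightarrow> 'm \<Rightarrow> ('m tvec \<Rightarrow> 'm tvec) \<Rightarrow> real"
  where "tangent_trace M p F =
    (let c = chart_at M p in \<Sum>i\<in>UNIV. components c (F (coord_vec M c p (axis i 1))) $ i)"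


section \<open>Semi-Riemannian metrics and the Levi-Civita connection\<close>

text \<open>A metric tensor is a smooth symmetric nondegenerate (0,2)-tensor field of constant index.\<close>

definition semi_riemannian :: "('m, 'n::finite, 'z) sr_manifold_scheme \<Rightarrow> bool"
  where "semi_riemannian M \<longleftrightarrow>
    smooth_manifold M \<and>
    (\<forall>p\<in>topspace (top_of M). \<forall>u\<in>tangent M p. \<forall>v\<in>tangent M p. \<forall>w\<in>tangent M p. \<forall>a b.
       metric_tensor M p (\<lambda>f. a * u f + b * v f) w
         = a * metric_tensor M p u w + b * metric_tensor M p v w) \<and>
    (\<forall>p\<in>topspace (top_of M). \<forall>u\<in>tangent M p. \<forall>v\<in>tangent M p.
       metric_tensor M p u v = metric_tensor M p v u) \<and>
    (\<forall>p\<in>topspace (top_of M). \<forall>u\<in>tangent M p.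
       (\<forall>v\<in>tangent M p. metric_tensor M p u v = 0) \<longrightarrow> u = (\<lambda>f. 0)) \<and>
    (\<forall>W X Y. openin (top_of M) W \<and> smooth_vfield M W X \<and> smooth_vfield M W Y \<longrightarrow>
       smooth_fun M W (\<lambda>q. metric_tensor M q (X q) (Y q))) \<and>
    (\<exists>\<nu>. \<forall>c\<in>atlas M. \<forall>p\<in>fst c.
       Max {dim V | V. subspace V \<and>
              (\<forall>w\<in>V - {0}. metric_tensor M p (coord_vec M c p w) (coord_vec M c p w) < 0)} = \<nu>)"

text \<open>A connection is a total function on pairs of vector fields; its values are only constrained
  at points near which both fields are smooth. Because the axioms are imposed over every open
  \<open>W\<close> and fields need only be smooth there, \<open>(D X Y) p\<close> depends only on the germs of \<open>X\<close> and
  \<open>Y\<close> at \<open>p\<close> (multiply the fields by the indicator function of a neighbourhood of \<open>p\<close>).\<close>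

definition linear_connection ::
    "('m, 'n::finite, 'z) manifold_scheme \<Rightarrow> ('m vfield \<Rightarrow> 'm vfield \<Rightarrow> 'm vfield) \<Rightarrow> bool"
  where "linear_connection M D \<longleftrightarrow>
    (\<forall>W X Y. openin (top_of M) W \<and> smooth_vfield M W X \<and> smooth_vfield M W Y \<longrightarrow>
       smooth_vfield M W (D X Y)) \<and>
    (\<forall>W X X' Y. openin (top_of M) W \<and> smooth_vfield M W X \<and> smooth_vfield M W X' \<and>
         smooth_vfield M W Y \<longrightarrow>
       (\<forall>p\<in>W. D (\<lambda>q h. X q h + X' q h) Y p = (\<lambda>h. D X Y p h + D X' Y p h))) \<and>
    (\<forall>W X Y f. openin (top_of M) W \<and> smooth_vfield M W X \<and> smooth_vfield M W Y \<and>
         smooth_fun M W f \<longrightarrow>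
       (\<forall>p\<in>W. D (\<lambda>q h. f q * X q h) Y p = (\<lambda>h. f p * D X Y p h))) \<and>
    (\<forall>W X Y Y'. openin (top_of M) W \<and> smooth_vfield M W X \<and> smooth_vfield M W Y \<and>
         smooth_vfield M W Y' \<longrightarrow>
       (\<forall>p\<in>W. D X (\<lambda>q h. Y q h + Y' q h) p = (\<lambda>h. D X Y p h + D X Y' p h))) \<and>
    (\<forall>W X Y f. openin (top_of M) W \<and> smooth_vfield M W X \<and> smooth_vfield M W Y \<and>
         smooth_fun M W f \<longrightarrow>
       (\<forall>p\<in>W. D X (\<lambda>q h. f q * Y q h) p = (\<lambda>h. X p f * Y p h + f p * D X Y p h)))"

definition levi_civita ::
    "('m, 'n::finite, 'z) sr_manifold_scheme \<Rightarrow> ('m vfield \<Rightarrow> 'm vfield \<Rightarrow> 'm vfield) \<Rightarrow> bool"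
  where "levi_civita M D \<longleftrightarrow>
    linear_connection M D \<and>
    (\<forall>W X Y. openin (top_of M) W \<and> smooth_vfield M W X \<and> smooth_vfield M W Y \<longrightarrow>
       (\<forall>p\<in>W. (\<lambda>h. D X Y p h - D Y X p h) = lie_bracket M X Y p)) \<and>
    (\<forall>W X Y Z. openin (top_of M) W \<and> smooth_vfield M W X \<and> smooth_vfield M W Y \<and>
         smooth_vfield M W Z \<longrightarrow>
       (\<forall>p\<in>W. X p (\<lambda>q. metric_tensor M q (Y q) (Z q))
          = metric_tensor M p (D X Y p) (Z p) + metric_tensor M p (Y p) (D X Z p)))"


section \<open>Curvature\<close>

text \<open>The convention is \<open>R(X,Y)Z = D\<^sub>X D\<^sub>Y Z - D\<^sub>Y D\<^sub>X Z - D\<^bsub>[X,Y]\<^esub> Z\<close>, for which constant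
  curvature \<open>c\<close> means \<open>R(X,Y)Z = c (g(Y,Z) X - g(X,Z) Y)\<close>.\<close>

definition curvature_vfield ::
    "('m, 'n::finite, 'z) manifold_scheme \<Rightarrow> ('m vfield \<Rightarrow> 'm vfield \<Rightarrow> 'm vfield) \<Rightarrow>
     'm vfield \<Rightarrow> 'm vfield \<Rightarrow> 'm vfield \<Rightarrow> 'm vfield"
  where "curvature_vfield M D X Y Z p =
    (\<lambda>h. D X (D Y Z) p h - D Y (D X Z) p h - D (lie_bracket M X Y) Z p h)"

text \<open>On tangent vectors at \<open>p\<close> the curvature tensor is evaluated by extending the vectors to
  local vector fields; by tensoriality the choice of the extensions is irrelevant, and the ones
  taken here have constant components in a chart around \<open>p\<close>.\<close>

definition extension :: "('m, 'n::finite, 'z) manifold_scheme \<Rightarrow> 'm \<Rightarrow> 'm tvec \<Rightarrow> 'm vfield"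
  where "extension M p v =
    (\<lambda>q. coord_vec M (chart_at M p) q (components (chart_at M p) v))"

definition curvature ::
    "('m, 'n::finite, 'z) manifold_scheme \<Rightarrow> ('m vfield \<Rightarrow> 'm vfield \<Rightarrow> 'm vfield) \<Rightarrow>
     'm \<Rightarrow> 'm tvec \<Rightarrow> 'm tvec \<Rightarrow> 'm tvec \<Rightarrow> 'm tvec"
  where "curvature M D p x y z =
    curvature_vfield M D (extension M p x) (extension M p y) (extension M p z) p"

definition curvature4 ::
    "('m, 'n::finite, 'z) sr_manifold_scheme \<Rightarrow> ('m vfield \<Rightarrow> 'm vfield \<Rightarrow> 'm vfield) \<Rightarrow>
     'm \<Rightarrow> 'm tvec \<Rightarrow> 'm tvec \<Rightarrow> 'm tvec \<Rightarrow> 'm tvec \<Rightarrow> real"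
  where "curvature4 M D p x y z v = metric_tensor M p (curvature M D p x y z) v"

definition ricci ::
    "('m, 'n::finite, 'z) manifold_scheme \<Rightarrow> ('m vfield \<Rightarrow> 'm vfield \<Rightarrow> 'm vfield) \<Rightarrow>
     'm \<Rightarrow> 'm tvec \<Rightarrow> 'm tvec \<Rightarrow> real"
  where "ricci M D p y z = tangent_trace M p (\<lambda>x. curvature M D p x y z)"

definition ricci_op ::
    "('m, 'n::finite, 'z) sr_manifold_scheme \<Rightarrow> ('m vfield \<Rightarrow> 'm vfield \<Rightarrow> 'm vfield) \<Rightarrow>
     'm \<Rightarrow> 'm tvec \<Rightarrow> 'm tvec"
  where "ricci_op M D p x =
    (THE q. q \<in> tangent M p \<and> (\<forall>y\<in>tangent M p. metric_tensor M p q y = ricci M D p x y))"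

definition scalar_curvature ::
    "('m, 'n::finite, 'z) sr_manifold_scheme \<Rightarrow> ('m vfield \<Rightarrow> 'm vfield \<Rightarrow> 'm vfield) \<Rightarrow> 'm \<Rightarrow> real"
  where "scalar_curvature M D p = tangent_trace M p (ricci_op M D p)"


section \<open>\<open>(N(k),\<xi>)\<close>-semi-Riemannian manifolds\<close>

definition nullity_distribution ::
    "('m, 'n::finite, 'z) sr_manifold_scheme \<Rightarrow> ('m vfield \<Rightarrow> 'm vfield \<Rightarrow> 'm vfield) \<Rightarrow>
     real \<Rightarrow> 'm \<Rightarrow> 'm tvec set"
  where "nullity_distribution M D k p =
    {z \<in> tangent M p. \<forall>x\<in>tangent M p. \<forall>y\<in>tangent M p.
       curvature M D p x y z
         = (\<lambda>f. k * (metric_tensor M p y z * x f - metric_tensor M p x z * y f))}"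

definition Nk_semi_riemannian ::
    "('m, 'n::finite, 'z) sr_manifold_scheme \<Rightarrow> ('m vfield \<Rightarrow> 'm vfield \<Rightarrow> 'm vfield) \<Rightarrow>
     real \<Rightarrow> 'm vfield \<Rightarrow> real \<Rightarrow> bool"
  where "Nk_semi_riemannian M D k \<xi> \<epsilon> \<longleftrightarrow>
    semi_riemannian M \<and> levi_civita M D \<and> \<epsilon> \<in> {1, -1} \<and>
    smooth_vfield M (topspace (top_of M)) \<xi> \<and>
    (\<forall>p\<in>topspace (top_of M). metric_tensor M p (\<xi> p) (\<xi> p) = \<epsilon> \<and>
       \<xi> p \<in> nullity_distribution M D k p)"


section \<open>The tensor \<open>T\<^sub>a\<close> and pseudosymmetry\<close>

text \<open>Of the sequence \<open>a\<close> only \<open>a 0, \<dots>, a 7\<close> are used.\<close>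

definition T_tensor ::
    "('m, 'n::finite, 'z) sr_manifold_scheme \<Rightarrow> ('m vfield \<Rightarrow> 'm vfield \<Rightarrow> 'm vfield) \<Rightarrow>
     (nat \<Rightarrow> real) \<Rightarrow> 'm \<Rightarrow> 'm tvec \<Rightarrow> 'm tvec \<Rightarrow> 'm tvec \<Rightarrow> 'm tvec"
  where "T_tensor M D a p x y z =
    (let g = metric_tensor M p; S = ricci M D p; Q = ricci_op M D p; r = scalar_curvature M D p in
     (\<lambda>f. a 0 * curvature M D p x y z f
        + a 1 * S y z * x f + a 2 * S x z * y f + a 3 * S x y * z f
        + a 4 * g y z * Q x f + a 5 * g x z * Q y f + a 6 * g x y * Q z f
        + a 7 * r * (g y z * x f - g x z * y f)))"

text \<open>The derivation \<open>F \<cdot> T\<close> induced by an endomorphism \<open>F\<close> of a tangent space.\<close>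

definition endo_act ::
    "('m tvec \<Rightarrow> 'm tvec) \<Rightarrow> ('m tvec \<Rightarrow> 'm tvec \<Rightarrow> 'm tvec \<Rightarrow> 'm tvec) \<Rightarrow>
     'm tvec \<Rightarrow> 'm tvec \<Rightarrow> 'm tvec \<Rightarrow> 'm tvec"
  where "endo_act F T u v w =
    (\<lambda>f. F (T u v w) f - T (F u) v w f - T u (F v) w f - T u v (F w) f)"

definition wedge ::
    "('m, 'n::finite, 'z) sr_manifold_scheme \<Rightarrow> 'm \<Rightarrow> 'm tvec \<Rightarrow> 'm tvec \<Rightarrow> 'm tvec \<Rightarrow> 'm tvec"
  where "wedge M p z x y =
    (\<lambda>f. metric_tensor M p x y * z f - metric_tensor M p z y * x f)"

definition U_set ::
    "('m, 'n::finite, 'z) sr_manifold_scheme \<Rightarrow> ('m vfield \<Rightarrow> 'm vfield \<Rightarrow> 'm vfield) \<Rightarrow>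
     (nat \<Rightarrow> real) \<Rightarrow> 'm set"
  where "U_set M D a = {p \<in> topspace (top_of M).
    \<exists>u\<in>tangent M p. \<exists>v\<in>tangent M p. \<exists>w\<in>tangent M p. T_tensor M D a p u v w \<noteq> (\<lambda>f. 0)}"

text \<open>\<open>T\<^sub>a\<close>-pseudosymmetry with the given function \<open>L\<close>: \<open>R \<cdot> T\<^sub>a = L Q(g, T\<^sub>a)\<close> where \<open>T\<^sub>a\<close> does
  not vanish.\<close>

definition T_pseudosymmetric ::
    "('m, 'n::finite, 'z) sr_manifold_scheme \<Rightarrow> ('m vfield \<Rightarrow> 'm vfield \<Rightarrow> 'm vfield) \<Rightarrow>
     (nat \<Rightarrow> real) \<Rightarrow> ('m \<Rightarrow> real) \<Rightarrow> bool"
  where "T_pseudosymmetric M D a L \<longleftrightarrow>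
    smooth_fun M (U_set M D a) L \<and>
    (\<forall>p\<in>U_set M D a. \<forall>u\<in>tangent M p. \<forall>v\<in>tangent M p. \<forall>w\<in>tangent M p.
     \<forall>z\<in>tangent M p. \<forall>x\<in>tangent M p.
       endo_act (curvature M D p z x) (T_tensor M D a p) u v w
         = (\<lambda>f. L p * endo_act (wedge M p z x) (T_tensor M D a p) u v w f))"

end

theory Submission
  imports Defs
begin

text \<open>
  The identity is the \<open>\<xi>\<close>-component of the pseudosymmetry condition with \<open>Z = \<xi>\<close>. Pair symmetry
  of the curvature turns the nullity condition into \<open>R(\<xi>, X) Y = k (\<xi> \<and> X) Y\<close> (\<open>R_xi_left\<close>).
  Writing \<open>B\<close> for the pairing of \<open>((\<xi> \<and> X) \<cdot> T\<^sub>a)(U, V) W\<close> with \<open>\<xi>\<close>, pseudosymmetry therefore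
  reads \<open>k B = L B\<close>, and both sides of the claim are this equation written out.

  To evaluate \<open>B\<close>, note that pairing with \<open>\<xi>\<close> makes almost everything explicit:
  \<open>g(R(x, y) z, \<xi>)\<close> is known from the nullity condition and skewness, and \<open>\<xi>\<close> is an eigenvector of
  the Ricci tensor with eigenvalue \<open>k (n - 1)\<close> (\<open>ricci_xi\<close>). What remains is the polynomial
  identity of \<open>wedge_action_contracted\<close>.

  The geometric input is thus confined to the algebraic symmetries of the curvature at one point:
  antisymmetry, the first Bianchi identity and skewness with respect to the metric
  (\<open>curvature_vfield_swap\<close>, \<open>curvature_vfield_bianchi\<close>, \<open>curvature_vfield_skew\<close>), which come
  from the axioms of the Levi-Civita connection and the Jacobi identity. Pair symmetry, linearity
  of the curvature and symmetry of the Ricci tensor follow from these by linear algebra in the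
  tangent space. Reaching them requires that tangent vectors form a vector space with a coordinate
  basis and that vectors extend to smooth fields, hence some calculus of smooth maps.
\<close>

section \<open>Calculus of smooth maps\<close>

text \<open>The derivative is a choice among the linear maps that satisfy the derivative property, and
  both functions have the same such maps.\<close>

lemma frechet_derivative_cong_open:
  assumes "open S" "x \<in> S" "\<And>y. y \<in> S \<Longrightarrow> f y = g y"
  shows "frechet_derivative f (at x) = frechet_derivative g (at x)"
proof -
  have "(f has_derivative f') (at x) \<longleftrightarrow> (g has_derivative f') (at x)" for f'
    using assms by (metis has_derivative_transform_within_open)
  then show ?thesis
    by (simp add: frechet_derivative_def)
qed

lemma differentiable_cong_open:
  assumes "open S" "x \<in> S" "\<And>y. y \<in> S \<Longrightarrow> f y = g y" "f differentiable (at x)"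
  shows "g differentiable (at x)"
  using assms unfolding differentiable_def by (metis has_derivative_transform_within_open)

lemma frechet_derivativeD:
  "f differentiable (at x) \<Longrightarrow> (f has_derivative frechet_derivative f (at x)) (at x)"
  by (simp add: frechet_derivative_works)

lemma Ck_on_cong:
  assumes "open S" "\<And>x. x \<in> S \<Longrightarrow> f x = g x" "Ck_on k f S"
  shows "Ck_on k g S"
  using assms(2,3)
proof (induction k arbitrary: f g)
  case 0
  then show ?case by (metis Ck_on.simps(1) continuous_on_cong)
next
  case (Suc k)
  have "g differentiable (at x)" if "x \<in> S" for x
    using Suc.prems that differentiable_cong_open[OF assms(1) that] by auto
  moreover have "Ck_on k (\<lambda>x. frechet_derivative g (at x) v) S" for v
  proof (rule Suc.IH)
    show "frechet_derivative f (at x) v = frechet_derivative g (at x) v" if "x \<in> S" for x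
      using frechet_derivative_cong_open[OF assms(1) that] Suc.prems(1) by metis
  qed (use Suc.prems in auto)
  ultimately show ?case by simp
qed

lemma Ck_on_subset: "Ck_on k f S \<Longrightarrow> S' \<subseteq> S \<Longrightarrow> Ck_on k f S'"
  by (induction k arbitrary: f) (auto intro: continuous_on_subset)

lemma Ck_on_SucD: "Ck_on (Suc k) f S \<Longrightarrow> Ck_on k f S"
proof (induction k arbitrary: f)
  case 0
  then show ?case
    by (auto intro!: continuous_at_imp_continuous_on differentiable_imp_continuous_within)
next
  case (Suc k)
  show ?case
    unfolding Ck_on.simps(2)[of k]
  proof (intro conjI allI)
    fix v
    show "Ck_on k (\<lambda>x. frechet_derivative f (at x) v) S"
      using Suc.prems by (intro Suc.IH) (simp only: Ck_on.simps(2)[of "Suc k"])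
  qed (use Suc.prems in auto)
qed

lemma Ck_on_const: "Ck_on k (\<lambda>x. c) S"
  by (induction k arbitrary: c) auto

lemma Ck_on_bounded_linear:
  assumes "open S" "bounded_linear h" "Ck_on k f S"
  shows "Ck_on k (\<lambda>x. h (f x)) S"
  using assms(3)
proof (induction k arbitrary: f)
  case 0
  then show ?case
    using assms(2) by (simp add: bounded_linear.continuous_on)
next
  case (Suc k)
  have d: "((\<lambda>x. h (f x)) has_derivative (\<lambda>v. h (frechet_derivative f (at x) v))) (at x)"
    if "x \<in> S" for x
    using that Suc.prems
    by (intro bounded_linear.has_derivative[OF assms(2)] frechet_derivativeD) auto
  have "Ck_on k (\<lambda>x. frechet_derivative (\<lambda>x. h (f x)) (at x) v) S" for v
  proof (rule Ck_on_cong[OF assms(1)])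
    show "Ck_on k (\<lambda>x. h (frechet_derivative f (at x) v)) S"
      using Suc by auto
  qed (simp add: frechet_derivative_at[OF d, symmetric])
  then show ?case
    using d unfolding Ck_on.simps differentiable_def by blast
qed

lemma Ck_on_add:
  assumes "open S" "Ck_on k f S" "Ck_on k g S"
  shows "Ck_on k (\<lambda>x. f x + g x) S"
  using assms(2,3)
proof (induction k arbitrary: f g)
  case 0
  then show ?case by (simp add: continuous_on_add)
next
  case (Suc k)
  have d: "((\<lambda>x. f x + g x) has_derivative
      (\<lambda>v. frechet_derivative f (at x) v + frechet_derivative g (at x) v)) (at x)" if "x \<in> S" for x
    using that Suc.prems by (intro has_derivative_add frechet_derivativeD) auto
  have "Ck_on k (\<lambda>x. frechet_derivative (\<lambda>x. f x + g x) (at x) v) S" for v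
  proof (rule Ck_on_cong[OF assms(1)])
    show "Ck_on k (\<lambda>x. frechet_derivative f (at x) v + frechet_derivative g (at x) v) S"
      using Suc by auto
  qed (simp add: frechet_derivative_at[OF d, symmetric])
  then show ?case
    using d unfolding Ck_on.simps differentiable_def by blast
qed

lemma Ck_on_sum:
  assumes "open S" "\<And>i. i \<in> I \<Longrightarrow> Ck_on k (f i) S"
  shows "Ck_on k (\<lambda>x. \<Sum>i\<in>I. f i x) S"
  using assms(2)
  by (induction I rule: infinite_finite_induct) (simp_all add: Ck_on_const Ck_on_add[OF assms(1)])

lemma Ck_on_scaleR:
  fixes f :: "'a::real_normed_vector \<Rightarrow> real" and g :: "'a \<Rightarrow> 'b::real_normed_vector"
  assumes "open S" "Ck_on k f S" "Ck_on k g S"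
  shows "Ck_on k (\<lambda>x. f x *\<^sub>R g x) S"
  using assms(2,3)
proof (induction k arbitrary: f g)
  case 0
  then show ?case by (simp add: continuous_on_scaleR)
next
  case (Suc k)
  have d: "((\<lambda>x. f x *\<^sub>R g x) has_derivative
      (\<lambda>v. f x *\<^sub>R frechet_derivative g (at x) v + frechet_derivative f (at x) v *\<^sub>R g x)) (at x)"
    if "x \<in> S" for x
    using that Suc.prems by (intro has_derivative_scaleR frechet_derivativeD) auto
  have "Ck_on k (\<lambda>x. frechet_derivative (\<lambda>x. f x *\<^sub>R g x) (at x) v) S" for v
  proof (rule Ck_on_cong[OF assms(1)])
    show "Ck_on k (\<lambda>x. f x *\<^sub>R frechet_derivative g (at x) v
            + frechet_derivative f (at x) v *\<^sub>R g x) S"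
      using Suc by (intro Ck_on_add[OF assms(1)] Suc.IH)
        (simp_all add: Ck_on_SucD del: Ck_on.simps, simp_all)
  qed (simp add: frechet_derivative_at[OF d, symmetric])
  then show ?case
    using d unfolding Ck_on.simps differentiable_def by blast
qed

text \<open>By the chain rule the derivative of the composite is, after expanding the inner derivative
  in a basis, a finite sum of products of directional derivatives of \<open>f\<close> along \<open>g\<close> with
  components of the derivative of \<open>g\<close>. The induction therefore needs only closure under sums
  and products, applied to functions that are one order less regular.\<close>

lemma Ck_on_compose:
  fixes f :: "'b::euclidean_space \<Rightarrow> 'c::real_normed_vector"
    and g :: "'a::real_normed_vector \<Rightarrow> 'b"
  assumes "open A" "g ` A \<subseteq> B" "Ck_on k f B" "Ck_on k g A"
  shows "Ck_on k (\<lambda>x. f (g x)) A"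
  using assms(3,4)
proof (induction k arbitrary: f)
  case 0
  then show ?case
    using assms(2) by (simp add: continuous_on_compose2)
next
  case (Suc k)
  let ?f' = "\<lambda>x. frechet_derivative f (at (g x))" and ?g' = "\<lambda>x. frechet_derivative g (at x)"
  have f': "(f has_derivative ?f' x) (at (g x))" if "x \<in> A" for x
    using that Suc.prems assms(2) by (intro frechet_derivativeD) auto
  have d: "((\<lambda>x. f (g x)) has_derivative (\<lambda>v. ?f' x (?g' x v))) (at x)" if "x \<in> A" for x
    using has_derivative_compose[of g "?g' x" x UNIV f "?f' x"] f'[OF that] Suc.prems(2) that
    by (simp add: frechet_derivativeD)
  have g: "Ck_on k g A"
    using Suc.prems(2) by (rule Ck_on_SucD)
  have "Ck_on k (\<lambda>x. frechet_derivative (\<lambda>x. f (g x)) (at x) v) A" for v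
  proof (rule Ck_on_cong[OF assms(1)])
    show "Ck_on k (\<lambda>x. \<Sum>b\<in>Basis. (?g' x v \<bullet> b) *\<^sub>R ?f' x b) A"
      using Suc g
      by (intro Ck_on_sum Ck_on_scaleR Ck_on_bounded_linear[OF _ bounded_linear_inner_left] assms(1)) auto
    show "(\<Sum>b\<in>Basis. (?g' x v \<bullet> b) *\<^sub>R ?f' x b) = frechet_derivative (\<lambda>x. f (g x)) (at x) v"
      if "x \<in> A" for x
    proof -
      interpret linear "?f' x"
        using f'[OF that] by (rule has_derivative_linear)
      have "?f' x (?g' x v) = ?f' x (\<Sum>b\<in>Basis. (?g' x v \<bullet> b) *\<^sub>R b)"
        by (simp add: euclidean_representation)
      then show ?thesis
        by (simp add: frechet_derivative_at[OF d[OF that], symmetric] sum scaleR)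
    qed
  qed
  then show ?case
    using d unfolding Ck_on.simps differentiable_def by blast
qed

lemma smooth_on_cong:
  assumes "open S" "smooth_on S f" "\<And>x. x \<in> S \<Longrightarrow> f x = g x"
  shows "smooth_on S g"
  using assms(2) Ck_on_cong[of S f g, OF assms(1,3)] unfolding smooth_on_def by blast

lemma smooth_on_subset: "smooth_on S f \<Longrightarrow> S' \<subseteq> S \<Longrightarrow> smooth_on S' f"
  unfolding smooth_on_def by (blast intro: Ck_on_subset)

lemma smooth_on_Suc: "smooth_on S f \<Longrightarrow> Ck_on (Suc k) f S"
  unfolding smooth_on_def by blast

lemma smooth_on_differentiable: "smooth_on S f \<Longrightarrow> x \<in> S \<Longrightarrow> f differentiable (at x)"
  using smooth_on_Suc[of S f 0] by simp

lemma smooth_on_frechet_derivative: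
  "smooth_on S f \<Longrightarrow> smooth_on S (\<lambda>x. frechet_derivative f (at x) v)"
  using smooth_on_Suc[of S f] unfolding Ck_on.simps smooth_on_def by blast

lemma smooth_on_compose:
  fixes f :: "'b::euclidean_space \<Rightarrow> 'c::real_normed_vector"
  assumes "open A" "smooth_on B f" "smooth_on A g" "g ` A \<subseteq> B"
  shows "smooth_on A (\<lambda>x. f (g x))"
  using assms unfolding smooth_on_def by (blast intro: Ck_on_compose)

section \<open>Charts and tangent vectors\<close>

locale smooth_mfd =
  fixes M :: "('m, 'n::finite, 'z) manifold_scheme"
  assumes smooth_manifold: "smooth_manifold M"
begin

lemma chart_openin: "c \<in> atlas M \<Longrightarrow> openin (top_of M) (fst c)"
  using smooth_manifold unfolding smooth_manifold_def is_chart_def by blast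

lemma chart_inj: "c \<in> atlas M \<Longrightarrow> inj_on (snd c) (fst c)"
proof -
  assume c: "c \<in> atlas M"
  have "homeomorphic_map (subtopology (top_of M) (fst c)) (top_of_set (snd c ` fst c)) (snd c)"
    using smooth_manifold c unfolding smooth_manifold_def is_chart_def by blast
  then have "inj_on (snd c) (topspace (subtopology (top_of M) (fst c)))"
    by (simp add: homeomorphic_eq_everything_map)
  then show "inj_on (snd c) (fst c)"
    using openin_subset[OF chart_openin[OF c]] by (simp add: Int_absorb1 inf.absorb2)
qed

lemma chart_inv_chart: "c \<in> atlas M \<Longrightarrow> q \<in> fst c \<Longrightarrow> chart_inv c (snd c q) = q"
  by (simp add: chart_inj)

lemma open_chart_image:
  assumes "c \<in> atlas M" "openin (top_of M) W"
  shows "open (snd c ` (fst c \<inter> W))"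
proof -
  have c: "open (snd c ` fst c)"
    "homeomorphic_map (subtopology (top_of M) (fst c)) (top_of_set (snd c ` fst c)) (snd c)"
    using smooth_manifold assms(1) unfolding smooth_manifold_def is_chart_def by blast+
  have "openin (subtopology (top_of M) (fst c)) (fst c \<inter> W)"
    using assms(2) openin_subtopology_Int2 by blast
  then have "openin (top_of_set (snd c ` fst c)) (snd c ` (fst c \<inter> W))"
    using homeomorphic_imp_open_map[OF c(2)] unfolding open_map_def by blast
  then show ?thesis
    using c(1) openin_open_trans by blast
qed

lemma transition_smooth:
  "c \<in> atlas M \<Longrightarrow> d \<in> atlas M \<Longrightarrow> smooth_on (snd c ` (fst c \<inter> fst d)) (snd d \<circ> chart_inv c)"
  using smooth_manifold unfolding smooth_manifold_def by blast

lemma chart_at: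
  assumes "p \<in> topspace (top_of M)"
  shows "chart_at M p \<in> atlas M" "p \<in> fst (chart_at M p)"
proof -
  have "\<exists>c. c \<in> atlas M \<and> p \<in> fst c"
    using smooth_manifold assms unfolding smooth_manifold_def by blast
  from someI_ex[OF this] show "chart_at M p \<in> atlas M" "p \<in> fst (chart_at M p)"
    unfolding chart_at_def by auto
qed

lemma smooth_fun_cong:
  assumes "openin (top_of M) W" "smooth_fun M W f" "\<And>q. q \<in> W \<Longrightarrow> f q = h q"
  shows "smooth_fun M W h"
  unfolding smooth_fun_def
proof
  fix c assume c: "c \<in> atlas M"
  show "smooth_on (snd c ` (fst c \<inter> W)) (h \<circ> chart_inv c)"
  proof (rule smooth_on_cong[OF open_chart_image[OF c assms(1)]])
    show "smooth_on (snd c ` (fst c \<inter> W)) (f \<circ> chart_inv c)"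
      using assms(2) c unfolding smooth_fun_def by blast
  qed (use assms(3) chart_inv_chart[OF c] in auto)
qed

lemma smooth_fun_subset: "smooth_fun M W f \<Longrightarrow> W' \<subseteq> W \<Longrightarrow> smooth_fun M W' f"
  unfolding smooth_fun_def by (meson Int_mono image_mono order_refl smooth_on_subset)

lemma smooth_fun_const: "smooth_fun M W (\<lambda>q. a)"
  unfolding smooth_fun_def smooth_on_def o_def by (simp add: Ck_on_const)

lemma smooth_fun_add:
  assumes "openin (top_of M) W" "smooth_fun M W f" "smooth_fun M W h"
  shows "smooth_fun M W (\<lambda>q. f q + h q)"
  using assms open_chart_image unfolding smooth_fun_def smooth_on_def o_def
  by (simp add: Ck_on_add)

lemma smooth_fun_minus:
  assumes "openin (top_of M) W" "smooth_fun M W f"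
  shows "smooth_fun M W (\<lambda>q. - f q)"
  using assms unfolding smooth_fun_def smooth_on_def o_def
  by (intro ballI allI Ck_on_bounded_linear[OF _ bounded_linear_minus[OF bounded_linear_ident]]
      open_chart_image) auto

lemma smooth_fun_diff:
  assumes "openin (top_of M) W" "smooth_fun M W f" "smooth_fun M W h"
  shows "smooth_fun M W (\<lambda>q. f q - h q)"
  using smooth_fun_add[OF assms(1,2) smooth_fun_minus[OF assms(1,3)]] by simp

lemma smooth_fun_coordinate:
  assumes "c \<in> atlas M"
  shows "smooth_fun M (fst c) (\<lambda>q. snd c q $ i)"
  unfolding smooth_fun_def
proof
  fix d assume d: "d \<in> atlas M"
  show "smooth_on (snd d ` (fst d \<inter> fst c)) ((\<lambda>q. snd c q $ i) \<circ> chart_inv d)"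
    using transition_smooth[OF d assms] unfolding smooth_on_def o_def
    by (intro allI Ck_on_bounded_linear[OF _ bounded_linear_vec_nth]
        open_chart_image[OF d chart_openin[OF assms]]) auto
qed

lemma smooth_nearI: "openin (top_of M) W \<Longrightarrow> p \<in> W \<Longrightarrow> smooth_fun M W f \<Longrightarrow> smooth_near M p f"
  unfolding smooth_near_def by blast

lemma smooth_near_cong:
  assumes "openin (top_of M) W" "p \<in> W" "\<And>q. q \<in> W \<Longrightarrow> f q = h q"
  shows "smooth_near M p f \<longleftrightarrow> smooth_near M p h"
proof -
  have "smooth_near M p h'"
    if n: "smooth_near M p f'" and eq: "\<And>q. q \<in> W \<Longrightarrow> f' q = h' q" for f' h'
  proof -
    obtain W' where "openin (top_of M) W'" "p \<in> W'" "smooth_fun M W' f'"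
      using n unfolding smooth_near_def by blast
    moreover from this have "smooth_fun M (W \<inter> W') h'"
      using assms(1) eq smooth_fun_cong[of "W \<inter> W'" f' h'] smooth_fun_subset[of W' f' "W \<inter> W'"]
      by (simp add: openin_Int)
    ultimately show ?thesis
      using assms(1,2) by (intro smooth_nearI[of "W \<inter> W'"]) auto
  qed
  from this[of f h] this[of h f] assms(3) show ?thesis by auto
qed

lemma smooth_near_differentiable:
  assumes "smooth_near M p f" "c \<in> atlas M" "p \<in> fst c"
  shows "(f \<circ> chart_inv c) differentiable (at (snd c p))"
proof -
  obtain W where W: "openin (top_of M) W" "p \<in> W" "smooth_fun M W f"
    using assms(1) unfolding smooth_near_def by blast
  then show ?thesis
    using assms(2,3) unfolding smooth_fun_def
    by (intro smooth_on_differentiable[of "snd c ` (fst c \<inter> W)"]) auto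
qed

lemma coord_vec_linear:
  assumes "c \<in> atlas M" "p \<in> fst c"
  shows "coord_vec M c p (a *\<^sub>R w + b *\<^sub>R w') = (\<lambda>f. a * coord_vec M c p w f + b * coord_vec M c p w' f)"
proof
  fix f
  show "coord_vec M c p (a *\<^sub>R w + b *\<^sub>R w') f = a * coord_vec M c p w f + b * coord_vec M c p w' f"
  proof (cases "smooth_near M p f")
    case True
    interpret linear "frechet_derivative (f \<circ> chart_inv c) (at (snd c p))"
      using frechet_derivativeD[OF smooth_near_differentiable[OF True assms]]
      by (rule has_derivative_linear)
    show ?thesis
      using True by (simp add: coord_vec_def add scaleR)
  qed (simp add: coord_vec_def)
qed

text \<open>The chain rule for the transition map. It lets all tangent vectors at a point be written in
  one chart, which is why they form a vector space although each of them may come with its own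
  chart.\<close>

lemma coord_vec_change_chart:
  assumes "c \<in> atlas M" "p \<in> fst c" "d \<in> atlas M" "p \<in> fst d"
  shows "coord_vec M c p w
    = coord_vec M d p (frechet_derivative (snd d \<circ> chart_inv c) (at (snd c p)) w)"
proof
  fix f
  let ?t = "snd d \<circ> chart_inv c"
  show "coord_vec M c p w f = coord_vec M d p (frechet_derivative ?t (at (snd c p)) w) f"
  proof (cases "smooth_near M p f")
    case True
    let ?S = "snd c ` (fst c \<inter> fst d)"
    have S: "open ?S" "snd c p \<in> ?S"
      using open_chart_image[OF assms(1) chart_openin[OF assms(3)]] assms(2,4) by auto
    have t: "(?t has_derivative frechet_derivative ?t (at (snd c p))) (at (snd c p))"
      by (intro frechet_derivativeD smooth_on_differentiable[OF transition_smooth] S(2) assms)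
    have "(f \<circ> chart_inv d has_derivative frechet_derivative (f \<circ> chart_inv d) (at (snd d p)))
        (at (?t (snd c p)))"
      using frechet_derivativeD[OF smooth_near_differentiable[OF True assms(3,4)]]
      by (simp add: chart_inv_chart assms)
    from has_derivative_compose[OF t this]
    have compose: "frechet_derivative (\<lambda>x. (f \<circ> chart_inv d) (?t x)) (at (snd c p))
        = (\<lambda>w. frechet_derivative (f \<circ> chart_inv d) (at (snd d p))
              (frechet_derivative ?t (at (snd c p)) w))"
      by (rule frechet_derivative_at[symmetric])
    have "frechet_derivative (\<lambda>x. (f \<circ> chart_inv d) (?t x)) (at (snd c p))
        = frechet_derivative (f \<circ> chart_inv c) (at (snd c p))"
      by (rule frechet_derivative_cong_open[OF S]) (auto simp: chart_inv_chart assms)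
    from trans[OF this[symmetric] compose] show ?thesis
      using True by (simp add: coord_vec_def)
  qed (simp add: coord_vec_def)
qed

lemma tangent_in_chart:
  assumes "v \<in> tangent M p" "c \<in> atlas M" "p \<in> fst c"
  obtains w where "v = coord_vec M c p w"
  using assms coord_vec_change_chart unfolding tangent_def by blast

lemma coord_vec_tangent: "c \<in> atlas M \<Longrightarrow> p \<in> fst c \<Longrightarrow> coord_vec M c p w \<in> tangent M p"
  unfolding tangent_def by blast

lemma tangent_lincomb:
  assumes "u \<in> tangent M p" "v \<in> tangent M p"
  shows "(\<lambda>f. a * u f + b * v f) \<in> tangent M p"
proof -
  obtain c w where c: "c \<in> atlas M" "p \<in> fst c" "u = coord_vec M c p w"
    using assms(1) unfolding tangent_def by blast
  obtain w' where "v = coord_vec M c p w'"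
    using tangent_in_chart[OF assms(2) c(1,2)] .
  with c show ?thesis
    by (simp add: coord_vec_linear[symmetric] coord_vec_tangent)
qed

lemma tangent_add: "u \<in> tangent M p \<Longrightarrow> v \<in> tangent M p \<Longrightarrow> (\<lambda>f. u f + v f) \<in> tangent M p"
  using tangent_lincomb[of u p v 1 1] by simp

lemma tangent_diff: "u \<in> tangent M p \<Longrightarrow> v \<in> tangent M p \<Longrightarrow> (\<lambda>f. u f - v f) \<in> tangent M p"
  using tangent_lincomb[of u p v 1 "-1"] by simp

lemma tangent_scale: "u \<in> tangent M p \<Longrightarrow> (\<lambda>f. a * u f) \<in> tangent M p"
  using tangent_lincomb[of u p u a 0] by simp

text \<open>Tangent vectors depend only on germs, including their default value 0 on functions that are
  not smooth near the point. Identities known only on an open set can thus be differentiated.\<close>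

lemma tangent_local:
  assumes "v \<in> tangent M p" "openin (top_of M) W" "p \<in> W" "\<And>q. q \<in> W \<Longrightarrow> f q = h q"
  shows "v f = v h"
proof -
  obtain c w where c: "c \<in> atlas M" "p \<in> fst c" "v = coord_vec M c p w"
    using assms(1) unfolding tangent_def by blast
  have "frechet_derivative (f \<circ> chart_inv c) (at (snd c p))
      = frechet_derivative (h \<circ> chart_inv c) (at (snd c p))"
    using c assms(3,4)
    by (intro frechet_derivative_cong_open[OF open_chart_image[OF c(1) assms(2)]])
      (auto simp: chart_inv_chart)
  moreover have "smooth_near M p f \<longleftrightarrow> smooth_near M p h"
    by (rule smooth_near_cong[OF assms(2-4)])
  ultimately show ?thesis
    by (simp add: c(3) coord_vec_def)
qed

lemma tangent_const: "v \<in> tangent M p \<Longrightarrow> v (\<lambda>q. a) = 0"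
  unfolding tangent_def coord_vec_def o_def by auto

lemma smooth_near_diff:
  assumes "smooth_near M p f" "smooth_near M p h"
  shows "smooth_near M p (\<lambda>q. f q - h q)"
proof -
  obtain W W' where "openin (top_of M) W" "p \<in> W" "smooth_fun M W f"
    "openin (top_of M) W'" "p \<in> W'" "smooth_fun M W' h"
    using assms unfolding smooth_near_def by blast
  then show ?thesis
    by (intro smooth_nearI[of "W \<inter> W'"] smooth_fun_diff) (auto intro: smooth_fun_subset)
qed

lemma tangent_diff_fun:
  assumes "v \<in> tangent M p" "smooth_near M p f" "smooth_near M p h"
  shows "v (\<lambda>q. f q - h q) = v f - v h"
proof -
  obtain c w where c: "c \<in> atlas M" "p \<in> fst c" "v = coord_vec M c p w"
    using assms(1) unfolding tangent_def by blast
  note d = frechet_derivativeD[OF smooth_near_differentiable[OF _ c(1,2)]]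
  have "frechet_derivative ((\<lambda>q. f q - h q) \<circ> chart_inv c) (at (snd c p))
     = (\<lambda>v. frechet_derivative (f \<circ> chart_inv c) (at (snd c p)) v
          - frechet_derivative (h \<circ> chart_inv c) (at (snd c p)) v)"
    using has_derivative_diff[OF d[OF assms(2)] d[OF assms(3)]]
    by (intro frechet_derivative_at[symmetric]) (simp add: o_def)
  then show ?thesis
    using smooth_near_diff[OF assms(2,3)] assms(2,3) by (simp add: c(3) coord_vec_def)
qed

lemma tangent_add_fun:
  assumes "v \<in> tangent M p" "smooth_near M p f" "smooth_near M p h"
  shows "v (\<lambda>q. f q + h q) = v f + v h"
proof -
  have n: "smooth_near M p (\<lambda>q. 0)"
    using assms(2) smooth_fun_const unfolding smooth_near_def by blast
  have "v (\<lambda>q. f q - (0 - h q)) = v f - v (\<lambda>q. 0 - h q)"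
    by (rule tangent_diff_fun[OF assms(1,2) smooth_near_diff[OF n assms(3)]])
  also have "\<dots> = v f + v h"
    using tangent_diff_fun[OF assms(1) n assms(3)] tangent_const[OF assms(1)] by simp
  finally show ?thesis by simp
qed

lemma components_coord_vec:
  assumes "c \<in> atlas M" "p \<in> fst c"
  shows "components c (coord_vec M c p w) = w"
proof -
  have "coord_vec M c p w (\<lambda>q. snd c q $ i) = w $ i" for i
  proof -
    have S: "open (snd c ` fst c)" "snd c p \<in> snd c ` fst c"
      using open_chart_image[OF assms(1) chart_openin[OF assms(1)]] assms(2) by auto
    have "frechet_derivative ((\<lambda>q. snd c q $ i) \<circ> chart_inv c) (at (snd c p))
        = frechet_derivative (\<lambda>x. x $ i) (at (snd c p))"
      by (rule frechet_derivative_cong_open[OF S]) (auto simp: chart_inv_chart assms)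
    also have "\<dots> = (\<lambda>x. x $ i)"
      by (intro frechet_derivative_at[symmetric] bounded_linear_imp_has_derivative
          bounded_linear_vec_nth)
    finally show ?thesis
      using smooth_nearI[OF chart_openin[OF assms(1)] assms(2) smooth_fun_coordinate[OF assms(1)]]
      by (simp add: coord_vec_def)
  qed
  then show ?thesis
    by (simp add: components_def vec_eq_iff)
qed

lemma coord_vec_components:
  assumes "v \<in> tangent M p" "c \<in> atlas M" "p \<in> fst c"
  shows "coord_vec M c p (components c v) = v"
  using tangent_in_chart[OF assms] components_coord_vec assms(2,3) by metis

section \<open>Smooth vector fields\<close>

lemma vfield_tangent: "smooth_vfield M W X \<Longrightarrow> p \<in> W \<Longrightarrow> X p \<in> tangent M p"
  unfolding smooth_vfield_def by blast

lemma vfield_smooth_fun: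
  "smooth_vfield M W X \<Longrightarrow> openin (top_of M) W' \<Longrightarrow> W' \<subseteq> W \<Longrightarrow> smooth_fun M W' f
    \<Longrightarrow> smooth_fun M W' (\<lambda>q. X q f)"
  unfolding smooth_vfield_def by blast

lemma vfield_cong:
  assumes "smooth_vfield M W X" "\<And>q. q \<in> W \<Longrightarrow> X q = Y q"
  shows "smooth_vfield M W Y"
  unfolding smooth_vfield_def
proof (intro conjI ballI allI impI)
  fix W' f assume W': "openin (top_of M) W' \<and> W' \<subseteq> W \<and> smooth_fun M W' f"
  then have "smooth_fun M W' (\<lambda>q. X q f)"
    using vfield_smooth_fun[OF assms(1)] by blast
  then show "smooth_fun M W' (\<lambda>q. Y q f)"
    using W' assms(2) by (elim smooth_fun_cong[rotated]) auto
qed (use vfield_tangent assms in metis)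

lemma vfield_diff:
  assumes "smooth_vfield M W X" "smooth_vfield M W Y"
  shows "smooth_vfield M W (\<lambda>q h. X q h - Y q h)"
  unfolding smooth_vfield_def
proof (intro conjI ballI allI impI)
  fix W' f assume "openin (top_of M) W' \<and> W' \<subseteq> W \<and> smooth_fun M W' f"
  then show "smooth_fun M W' (\<lambda>q. X q f - Y q f)"
    by (intro smooth_fun_diff vfield_smooth_fun[OF assms(1)] vfield_smooth_fun[OF assms(2)]) auto
qed (intro tangent_diff vfield_tangent[OF assms(1)] vfield_tangent[OF assms(2)])

text \<open>In another chart the derivative along a coordinate direction is a partial derivative composed
  with the transition map, so its smoothness rests on closure under composition. These fields
  are the extensions by which the curvature at a point is evaluated.\<close>

lemma coord_vfield_smooth:
  assumes "c \<in> atlas M"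
  shows "smooth_vfield M (fst c) (\<lambda>q. coord_vec M c q w)"
  unfolding smooth_vfield_def
proof (intro conjI ballI allI impI)
  fix W f assume W: "openin (top_of M) W \<and> W \<subseteq> fst c \<and> smooth_fun M W f"
  let ?f' = "\<lambda>x. frechet_derivative (f \<circ> chart_inv c) (at x) w"
  have f': "smooth_on (snd c ` (fst c \<inter> W)) ?f'"
    using W assms unfolding smooth_fun_def by (blast intro: smooth_on_frechet_derivative)
  have "smooth_fun M W (\<lambda>q. ?f' (snd c q))"
    unfolding smooth_fun_def
  proof
    fix d assume d: "d \<in> atlas M"
    let ?t = "snd c \<circ> chart_inv d" and ?S = "snd d ` (fst d \<inter> W)"
    have "smooth_on ?S (\<lambda>x. ?f' (?t x))"
    proof (rule smooth_on_compose[OF _ f'])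
      show "open ?S" using open_chart_image[OF d] W by blast
      show "smooth_on ?S ?t"
        using transition_smooth[OF d assms] by (rule smooth_on_subset) (use W in blast)
      show "?t ` ?S \<subseteq> snd c ` (fst c \<inter> W)"
        using W by (auto simp: chart_inv_chart[OF d])
    qed
    then show "smooth_on ?S ((\<lambda>q. ?f' (snd c q)) \<circ> chart_inv d)"
      by (simp add: o_def)
  qed
  then show "smooth_fun M W (\<lambda>q. coord_vec M c q w f)"
    by (rule smooth_fun_cong[rotated]) (use W in \<open>auto simp: coord_vec_def intro: smooth_nearI\<close>)
qed (rule coord_vec_tangent[OF assms])

lemma extension_smooth:
  "p \<in> topspace (top_of M) \<Longrightarrow> smooth_vfield M (fst (chart_at M p)) (extension M p v)"
  unfolding extension_def by (rule coord_vfield_smooth) (rule chart_at)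

lemma extension_value: "p \<in> topspace (top_of M) \<Longrightarrow> v \<in> tangent M p \<Longrightarrow> extension M p v p = v"
  unfolding extension_def by (rule coord_vec_components[OF _ chart_at])

lemma lie_bracket_apply:
  assumes "openin (top_of M) W" "smooth_fun M W f" "q \<in> W"
  shows "lie_bracket M X Y q f = X q (\<lambda>q. Y q f) - Y q (\<lambda>q. X q f)"
  using smooth_nearI[OF assms(1,3,2)] by (simp add: lie_bracket_def)

text \<open>On a function that is smooth near the point, the brackets expand into third-order terms
  that cancel in pairs. On any other function every bracket takes its default value 0.\<close>

lemma jacobi_identity:
  assumes W: "openin (top_of M) W" "p \<in> W"
    and X: "smooth_vfield M W X" and Y: "smooth_vfield M W Y" and Z: "smooth_vfield M W Z"
  shows "lie_bracket M X (lie_bracket M Y Z) p f + lie_bracket M Y (lie_bracket M Z X) p f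
       + lie_bracket M Z (lie_bracket M X Y) p f = 0"
proof (cases "smooth_near M p f")
  case True
  then obtain W' where W': "openin (top_of M) W'" "p \<in> W'" "smooth_fun M W' f"
    unfolding smooth_near_def by blast
  \<comment> \<open>On \<open>N\<close> the fields and \<open>f\<close> are all smooth, so brackets may be expanded there.\<close>
  define N where "N = W \<inter> W'"
  have N: "openin (top_of M) N" "p \<in> N" "N \<subseteq> W" "smooth_fun M N f"
    using W W' by (auto simp: N_def intro: smooth_fun_subset)
  have expand: "lie_bracket M A (lie_bracket M B C) p f
      = A p (\<lambda>q. B q (\<lambda>q. C q f)) - A p (\<lambda>q. C q (\<lambda>q. B q f))
        - B p (\<lambda>q. C q (\<lambda>q. A q f)) + C p (\<lambda>q. B q (\<lambda>q. A q f))"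
    if A: "smooth_vfield M W A" and B: "smooth_vfield M W B" and C: "smooth_vfield M W C" for A B C
  proof -
    have sm: "smooth_fun M N (\<lambda>q. E q h)" if "smooth_vfield M W E" "smooth_fun M N h" for E h
      using vfield_smooth_fun[OF that(1) N(1,3) that(2)] .
    have near: "smooth_near M p (\<lambda>q. E q (\<lambda>q. E' q f))"
      if "smooth_vfield M W E" "smooth_vfield M W E'" for E E'
      by (rule smooth_nearI[OF N(1,2) sm[OF that(1) sm[OF that(2) N(4)]]])
    have t: "A p \<in> tangent M p"
      using A W(2) by (rule vfield_tangent)
    have "A p (\<lambda>q. lie_bracket M B C q f) = A p (\<lambda>q. B q (\<lambda>q. C q f) - C q (\<lambda>q. B q f))"
      by (rule tangent_local[OF t N(1,2)]) (rule lie_bracket_apply[OF N(1,4)])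
    also have "\<dots> = A p (\<lambda>q. B q (\<lambda>q. C q f)) - A p (\<lambda>q. C q (\<lambda>q. B q f))"
      by (rule tangent_diff_fun[OF t near[OF B C] near[OF C B]])
    finally show ?thesis
      using lie_bracket_apply[OF N(1) sm[OF A N(4)] N(2)] lie_bracket_apply[OF N(1,4,2)] by simp
  qed
  show ?thesis
    by (simp add: expand X Y Z)
qed (simp add: lie_bracket_def)

lemma lie_bracket_swap: "lie_bracket M Y X = (\<lambda>q h. - 1 * lie_bracket M X Y q h)"
  by (intro ext) (simp add: lie_bracket_def)

end

section \<open>The Levi-Civita connection\<close>

locale sr_mfd =
  fixes M :: "('m, 'n::finite, 'z) sr_manifold_scheme"
    and D :: "'m vfield \<Rightarrow> 'm vfield \<Rightarrow> 'm vfield"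
  assumes semi_riemannian: "semi_riemannian M"
    and levi_civita: "levi_civita M D"

sublocale sr_mfd \<subseteq> smooth_mfd M
  using semi_riemannian by unfold_locales (simp add: semi_riemannian_def)

context sr_mfd
begin

abbreviation g where "g \<equiv> metric_tensor M"

lemma connection: "linear_connection M D"
  using levi_civita unfolding levi_civita_def by blast

lemma D_smooth:
  "openin (top_of M) W \<Longrightarrow> smooth_vfield M W X \<Longrightarrow> smooth_vfield M W Y \<Longrightarrow> smooth_vfield M W (D X Y)"
  using connection[unfolded linear_connection_def, THEN conjunct1] by blast

lemma D_scale_left:
  "openin (top_of M) W \<Longrightarrow> smooth_vfield M W X \<Longrightarrow> smooth_vfield M W Y \<Longrightarrow> smooth_fun M W f
    \<Longrightarrow> p \<in> W \<Longrightarrow> D (\<lambda>q h. f q * X q h) Y p = (\<lambda>h. f p * D X Y p h)"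
  using connection[unfolded linear_connection_def, THEN conjunct2, THEN conjunct2, THEN conjunct1] by blast

lemma D_add_right:
  "openin (top_of M) W \<Longrightarrow> smooth_vfield M W X \<Longrightarrow> smooth_vfield M W Y \<Longrightarrow> smooth_vfield M W Y'
    \<Longrightarrow> p \<in> W \<Longrightarrow> D X (\<lambda>q h. Y q h + Y' q h) p = (\<lambda>h. D X Y p h + D X Y' p h)"
  using connection[unfolded linear_connection_def, THEN conjunct2, THEN conjunct2, THEN conjunct2, THEN conjunct1] by blast

lemma D_leibniz:
  "openin (top_of M) W \<Longrightarrow> smooth_vfield M W X \<Longrightarrow> smooth_vfield M W Y \<Longrightarrow> smooth_fun M W f
    \<Longrightarrow> p \<in> W \<Longrightarrow> D X (\<lambda>q h. f q * Y q h) p = (\<lambda>h. X p f * Y p h + f p * D X Y p h)"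
  using connection[unfolded linear_connection_def, THEN conjunct2, THEN conjunct2, THEN conjunct2, THEN conjunct2] by blast

lemma torsion_free:
  "openin (top_of M) W \<Longrightarrow> smooth_vfield M W X \<Longrightarrow> smooth_vfield M W Y \<Longrightarrow> p \<in> W
    \<Longrightarrow> (\<lambda>h. D X Y p h - D Y X p h) = lie_bracket M X Y p"
  using levi_civita[unfolded levi_civita_def, THEN conjunct2, THEN conjunct1] by blast

lemma metric_compatible:
  "openin (top_of M) W \<Longrightarrow> smooth_vfield M W X \<Longrightarrow> smooth_vfield M W Y \<Longrightarrow> smooth_vfield M W Z
    \<Longrightarrow> p \<in> W \<Longrightarrow> X p (\<lambda>q. g q (Y q) (Z q)) = g p (D X Y p) (Z p) + g p (Y p) (D X Z p)"
  using levi_civita[unfolded levi_civita_def, THEN conjunct2, THEN conjunct2] by blast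

text \<open>The germ of the differentiated field at a point determines the derivative: multiplying
  both fields by the indicator function of the neighbourhood gives the same field, and by the
  Leibniz rule the multiplication does not change the derivative, since the indicator function
  is constantly 1 near the point.\<close>

lemma D_local:
  assumes W: "openin (top_of M) W" "p \<in> W"
    and X: "smooth_vfield M W X" and Y: "smooth_vfield M W Y"
    and eq: "\<And>q. q \<in> W \<Longrightarrow> Y q = Y' q"
  shows "D X Y p = D X Y' p"
proof -
  define f :: "'m \<Rightarrow> real" where "f = indicator W"
  have f: "smooth_fun M W f"
    using W(1) smooth_fun_const[of W 1] by (rule smooth_fun_cong) (simp add: f_def)
  have fp: "f p = 1"
    using W(2) by (simp add: f_def)
  have Xf: "X p f = 0"
    using tangent_local[OF vfield_tangent[OF X W(2)] W, of f "\<lambda>q. 1"]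
      tangent_const[OF vfield_tangent[OF X W(2)]] by (simp add: f_def)
  have Y': "smooth_vfield M W Y'"
    using Y eq by (rule vfield_cong)
  have "(\<lambda>q h. f q * Y q h) = (\<lambda>q h. f q * Y' q h)"
    by (intro ext) (simp add: f_def indicator_def eq)
  with D_leibniz[OF W(1) X Y f W(2)] D_leibniz[OF W(1) X Y' f W(2)] show ?thesis
    by (simp add: Xf fp)
qed

text \<open>Additivity applied to \<open>Y = (Y - Z) + Z\<close>.\<close>

lemma D_diff_right:
  assumes W: "openin (top_of M) W" "p \<in> W"
    and X: "smooth_vfield M W X" and Y: "smooth_vfield M W Y" and Z: "smooth_vfield M W Z"
  shows "D X (\<lambda>q h. Y q h - Z q h) p h = D X Y p h - D X Z p h"
  using D_add_right[OF W(1) X vfield_diff[OF Y Z] Z W(2)] by (simp add: fun_eq_iff)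

text \<open>A torsion-free connection writes the bracket as a difference of covariant derivatives, which
  are smooth. In particular the bracket, defined only as an operator on functions, is a field of
  tangent vectors.\<close>

lemma lie_bracket_smooth:
  assumes W: "openin (top_of M) W" and X: "smooth_vfield M W X" and Y: "smooth_vfield M W Y"
  shows "smooth_vfield M W (lie_bracket M X Y)"
  by (rule vfield_cong[OF vfield_diff[OF D_smooth[OF W X Y] D_smooth[OF W Y X]]])
    (rule torsion_free[OF W X Y])

lemma metric_lincomb:
  "p \<in> topspace (top_of M) \<Longrightarrow> u \<in> tangent M p \<Longrightarrow> v \<in> tangent M p \<Longrightarrow> w \<in> tangent M p
    \<Longrightarrow> g p (\<lambda>f. a * u f + b * v f) w = a * g p u w + b * g p v w"
  using semi_riemannian[unfolded semi_riemannian_def, THEN conjunct2, THEN conjunct1] by blast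

lemma metric_sym:
  "p \<in> topspace (top_of M) \<Longrightarrow> u \<in> tangent M p \<Longrightarrow> v \<in> tangent M p \<Longrightarrow> g p u v = g p v u"
  using semi_riemannian[unfolded semi_riemannian_def, THEN conjunct2, THEN conjunct2, THEN conjunct1] by blast

lemma metric_nondegenerate:
  "p \<in> topspace (top_of M) \<Longrightarrow> u \<in> tangent M p \<Longrightarrow> (\<And>v. v \<in> tangent M p \<Longrightarrow> g p u v = 0)
    \<Longrightarrow> u = (\<lambda>f. 0)"
  using semi_riemannian[unfolded semi_riemannian_def, THEN conjunct2, THEN conjunct2, THEN conjunct2, THEN conjunct1] by blast

lemma metric_smooth:
  "openin (top_of M) W \<Longrightarrow> smooth_vfield M W X \<Longrightarrow> smooth_vfield M W Y
    \<Longrightarrow> smooth_fun M W (\<lambda>q. g q (X q) (Y q))"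
  using semi_riemannian[unfolded semi_riemannian_def, THEN conjunct2, THEN conjunct2, THEN conjunct2, THEN conjunct2, THEN conjunct1] by blast

lemma metric_add:
  "p \<in> topspace (top_of M) \<Longrightarrow> u \<in> tangent M p \<Longrightarrow> v \<in> tangent M p \<Longrightarrow> w \<in> tangent M p
    \<Longrightarrow> g p (\<lambda>f. u f + v f) w = g p u w + g p v w"
  using metric_lincomb[of p u v w 1 1] by simp

lemma metric_diff:
  "p \<in> topspace (top_of M) \<Longrightarrow> u \<in> tangent M p \<Longrightarrow> v \<in> tangent M p \<Longrightarrow> w \<in> tangent M p
    \<Longrightarrow> g p (\<lambda>f. u f - v f) w = g p u w - g p v w"
  using metric_lincomb[of p u v w 1 "-1"] by simp

lemma metric_scale:
  "p \<in> topspace (top_of M) \<Longrightarrow> u \<in> tangent M p \<Longrightarrow> w \<in> tangent M p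
    \<Longrightarrow> g p (\<lambda>f. a * u f) w = a * g p u w"
  using metric_lincomb[of p u u w a 0] by simp

lemma metric_eqI:
  assumes "p \<in> topspace (top_of M)" "u \<in> tangent M p" "v \<in> tangent M p"
    and "\<And>w. w \<in> tangent M p \<Longrightarrow> g p u w = g p v w"
  shows "u = v"
proof -
  have "(\<lambda>f. u f - v f) = (\<lambda>f. 0)"
    by (rule metric_nondegenerate[OF assms(1) tangent_diff[OF assms(2,3)]])
      (simp add: metric_diff assms)
  then show ?thesis by (simp add: fun_eq_iff)
qed

section \<open>Curvature of vector fields\<close>

abbreviation CV where "CV \<equiv> curvature_vfield M D"

lemma curvature_vfield_swap:
  assumes W: "openin (top_of M) W" "p \<in> W"
    and X: "smooth_vfield M W X" and Y: "smooth_vfield M W Y" and Z: "smooth_vfield M W Z"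
  shows "CV Y X Z p h = - CV X Y Z p h"
  using D_scale_left[OF W(1) lie_bracket_smooth[OF W(1) X Y] Z smooth_fun_const W(2), of "-1"]
  by (simp add: curvature_vfield_def lie_bracket_swap[of Y X])

lemma curvature_vfield_tangent:
  assumes W: "openin (top_of M) W" "p \<in> W"
    and X: "smooth_vfield M W X" and Y: "smooth_vfield M W Y" and Z: "smooth_vfield M W Z"
  shows "CV X Y Z p \<in> tangent M p"
  unfolding curvature_vfield_def
  by (intro tangent_diff vfield_tangent[OF _ W(2)] D_smooth[OF W(1)] lie_bracket_smooth[OF W(1)] X Y Z)

text \<open>Without torsion, the difference of the two mixed second derivatives of a cyclic
  pair is the covariant derivative of a bracket; together with the last curvature term it
  becomes an iterated bracket. The cyclic sum vanishes by the Jacobi identity.\<close>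

lemma curvature_vfield_bianchi:
  assumes W: "openin (top_of M) W" "p \<in> W"
    and X: "smooth_vfield M W X" and Y: "smooth_vfield M W Y" and Z: "smooth_vfield M W Z"
  shows "CV X Y Z p h + CV Y Z X p h + CV Z X Y p h = 0"
proof -
  have br: "D A (D B C) p h - D A (D C B) p h - D (lie_bracket M B C) A p h
      = lie_bracket M A (lie_bracket M B C) p h"
    if A: "smooth_vfield M W A" and B: "smooth_vfield M W B" and C: "smooth_vfield M W C" for A B C
  proof -
    note BC = lie_bracket_smooth[OF W(1) B C]
    have "D A (lie_bracket M B C) p = D A (\<lambda>q h. D B C q h - D C B q h) p"
      by (rule D_local[OF W A BC]) (rule torsion_free[OF W(1) B C, symmetric])
    then have "D A (lie_bracket M B C) p h = D A (D B C) p h - D A (D C B) p h"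
      by (simp add: D_diff_right[OF W A D_smooth[OF W(1) B C] D_smooth[OF W(1) C B]])
    moreover have "D A (lie_bracket M B C) p h - D (lie_bracket M B C) A p h
        = lie_bracket M A (lie_bracket M B C) p h"
      using torsion_free[OF W(1) A BC W(2)] by (rule fun_cong)
    ultimately show ?thesis by simp
  qed
  show ?thesis
    using br[OF X Y Z] br[OF Y Z X] br[OF Z X Y] jacobi_identity[OF W X Y Z, of h]
    by (simp add: curvature_vfield_def)
qed

text \<open>Differentiating \<open>g(Z, V)\<close> twice with a metric connection produces mixed terms that are
  symmetric in \<open>X\<close> and \<open>Y\<close>. Antisymmetrising removes them, and metric compatibility along the
  bracket \<open>[X, Y]\<close> supplies the remaining term of each curvature.\<close>

lemma curvature_vfield_skew:
  assumes W: "openin (top_of M) W" "p \<in> W"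
    and X: "smooth_vfield M W X" and Y: "smooth_vfield M W Y"
    and Z: "smooth_vfield M W Z" and V: "smooth_vfield M W V"
  shows "g p (CV X Y Z p) (V p) = - g p (CV X Y V p) (Z p)"
proof -
  have p: "p \<in> topspace (top_of M)"
    using openin_subset[OF W(1)] W(2) by blast
  note sm = D_smooth[OF W(1)] lie_bracket_smooth[OF W(1) X Y]
  note tan = vfield_tangent[OF _ W(2)]
  let ?\<phi> = "\<lambda>q. g q (Z q) (V q)"
  have second: "A p (\<lambda>q. B q ?\<phi>) = g p (D A (D B Z) p) (V p) + g p (D B Z p) (D A V p)
      + g p (D A Z p) (D B V p) + g p (Z p) (D A (D B V) p)"
    if A: "smooth_vfield M W A" and B: "smooth_vfield M W B" for A B
  proof -
    have "A p (\<lambda>q. B q ?\<phi>) = A p (\<lambda>q. g q (D B Z q) (V q) + g q (Z q) (D B V q))"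
      by (rule tangent_local[OF tan[OF A] W]) (rule metric_compatible[OF W(1) B Z V])
    also have "\<dots> = A p (\<lambda>q. g q (D B Z q) (V q)) + A p (\<lambda>q. g q (Z q) (D B V q))"
      by (intro tangent_add_fun[OF tan[OF A]] smooth_nearI[OF W] metric_smooth[OF W(1)] sm B Z V)
    finally show ?thesis
      using metric_compatible[OF W(1) A sm(1)[OF B Z] V W(2)]
        metric_compatible[OF W(1) A Z sm(1)[OF B V] W(2)] by simp
  qed
  have "X p (\<lambda>q. Y q ?\<phi>) - Y p (\<lambda>q. X q ?\<phi>)
      = g p (D (lie_bracket M X Y) Z p) (V p) + g p (Z p) (D (lie_bracket M X Y) V p)"
    using lie_bracket_apply[OF W(1) metric_smooth[OF W(1) Z V] W(2), of X Y]
      metric_compatible[OF W(1) sm(2) Z V W(2)] by simp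
  moreover have "g p (CV X Y A p) (B p) = g p (D X (D Y A) p) (B p) - g p (D Y (D X A) p) (B p)
      - g p (D (lie_bracket M X Y) A p) (B p)"
    if A: "smooth_vfield M W A" and B: "smooth_vfield M W B" for A B
    unfolding curvature_vfield_def
    by (simp add: metric_diff p tangent_diff tan sm A B X Y)
  moreover have "g p (Z p) (A p) = g p (A p) (Z p)" if "smooth_vfield M W A" for A
    by (rule metric_sym[OF p tan[OF Z] tan[OF that]])
  ultimately show ?thesis
    by (simp add: second[OF X Y] second[OF Y X] Z V X Y sm)
qed

end

text \<open>The classical argument: four instances of the cyclic identity, one for each argument left
  out of the cycle, combine to the claim once the two antisymmetries have brought all terms to
  a common order.\<close>

lemma pair_symmetry:
  fixes R :: "'a \<Rightarrow> 'a \<Rightarrow> 'a \<Rightarrow> 'a \<Rightarrow> real"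
  assumes "\<And>x y z v. x \<in> T \<Longrightarrow> y \<in> T \<Longrightarrow> z \<in> T \<Longrightarrow> v \<in> T \<Longrightarrow> R y x z v = - R x y z v"
    and "\<And>x y z v. x \<in> T \<Longrightarrow> y \<in> T \<Longrightarrow> z \<in> T \<Longrightarrow> v \<in> T \<Longrightarrow> R x y v z = - R x y z v"
    and "\<And>x y z v. x \<in> T \<Longrightarrow> y \<in> T \<Longrightarrow> z \<in> T \<Longrightarrow> v \<in> T
          \<Longrightarrow> R x y z v + R y z x v + R z x y v = 0"
    and "x \<in> T" "y \<in> T" "z \<in> T" "v \<in> T"
  shows "R x y z v = R z v x y"
proof -
  note T = assms(4-7)
  show ?thesis
    using assms(3)[OF T(1,2,3,4)] assms(3)[OF T(2,3,4,1)] assms(3)[OF T(3,4,1,2)]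
      assms(3)[OF T(4,1,2,3)] assms(1)[OF T(1,3,2,4)] assms(1)[OF T(2,4,3,1)]
      assms(1)[OF T(1,4,3,2)] assms(1)[OF T(1,4,2,3)] assms(2)[OF T(2,3,1,4)]
      assms(2)[OF T(3,4,1,2)] assms(2)[OF T(2,4,1,3)] assms(2)[OF T(1,4,2,3)]
      assms(2)[OF T(1,3,2,4)] assms(2)[OF T(1,2,3,4)]
    by linarith
qed

section \<open>The tangent space at a point\<close>

locale sr_mfd_point = sr_mfd M D
  for M :: "('m, 'n::finite, 'z) sr_manifold_scheme"
    and D :: "'m vfield \<Rightarrow> 'm vfield \<Rightarrow> 'm vfield" +
  fixes p :: 'm
  assumes p: "p \<in> topspace (top_of M)"
begin

abbreviation "T \<equiv> tangent M p"
abbreviation G where "G \<equiv> metric_tensor M p"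
abbreviation R where "R \<equiv> curvature M D p"
abbreviation S where "S \<equiv> ricci M D p"
abbreviation Q where "Q \<equiv> ricci_op M D p"
abbreviation c where "c \<equiv> chart_at M p"
abbreviation e where "e i \<equiv> coord_vec M c p (axis i 1)"

lemmas G_sym = metric_sym[OF p] and G_eqI = metric_eqI[OF p]
lemmas G_linear = metric_add[OF p] metric_diff[OF p] metric_scale[OF p] metric_lincomb[OF p]
lemmas T_closed = tangent_add tangent_diff tangent_scale

lemma e_tangent: "e i \<in> T"
  by (rule coord_vec_tangent[OF chart_at[OF p]])

lemma components_lincomb:
  "components c (\<lambda>f. a * u f + b * v f) = a *\<^sub>R components c u + b *\<^sub>R components c v"
  by (simp add: components_def vec_eq_iff)

text \<open>Linear functionals on the tangent space are determined by the coordinate basis \<open>e\<close>. This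
  reduces identities on the tangent space to finitely many values, where matrices apply.\<close>

lemma linear_functional_expand:
  assumes lin: "\<And>u v a b. u \<in> T \<Longrightarrow> v \<in> T \<Longrightarrow> \<psi> (\<lambda>f. a * u f + b * v f) = a * \<psi> u + b * \<psi> v"
    and v: "v \<in> T"
  shows "\<psi> v = (\<Sum>i\<in>UNIV. components c v $ i * \<psi> (e i))"
proof -
  let ?L = "\<lambda>w. \<psi> (coord_vec M c p w)"
  have L: "?L (a *\<^sub>R w + b *\<^sub>R w') = a * ?L w + b * ?L w'" for a b w w'
    by (simp add: coord_vec_linear[OF chart_at[OF p]] lin coord_vec_tangent[OF chart_at[OF p]])
  have "linear ?L"
  proof (rule linearI)
    show "?L (w + w') = ?L w + ?L w'" for w w' using L[of 1 w 1 w'] by simp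
    show "?L (a *\<^sub>R w) = a *\<^sub>R ?L w" for a w using L[of a w 0 w] by simp
  qed
  then interpret linear ?L .
  have "?L (components c v) = ?L (\<Sum>i\<in>UNIV. components c v $ i *\<^sub>R axis i 1)"
    using basis_expansion[of "components c v"] by (simp add: scalar_mult_eq_scaleR)
  also have "\<dots> = (\<Sum>i\<in>UNIV. components c v $ i * \<psi> (e i))"
    by (simp add: sum scaleR)
  finally show ?thesis
    by (simp add: coord_vec_components[OF v chart_at[OF p]])
qed

definition gram :: "real^'n^'n" where "gram = (\<chi> i j. G (e i) (e j))"

lemma gram_symmetric: "transpose gram = gram"
  by (simp add: gram_def transpose_def vec_eq_iff G_sym[OF e_tangent e_tangent])

lemma metric_lincomb_right:
  assumes "u \<in> T" "v \<in> T" "w \<in> T"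
  shows "G w (\<lambda>f. a * u f + b * v f) = a * G w u + b * G w v"
  using G_sym[OF assms(3) tangent_lincomb[OF assms(1,2)]] G_sym[OF assms(3,1)] G_sym[OF assms(3,2)]
  by (simp add: metric_lincomb[OF p] assms)

lemma metric_gram:
  assumes "v \<in> T"
  shows "G (e i) v = (gram *v components c v) $ i"
proof -
  have "G (e i) v = (\<Sum>j\<in>UNIV. components c v $ j * G (e i) (e j))"
    by (rule linear_functional_expand[OF _ assms]) (simp add: metric_lincomb_right e_tangent)
  then show ?thesis
    by (simp add: gram_def matrix_vector_mult_def mult.commute)
qed

lemma metric_zeroI:
  assumes "v \<in> T" "\<And>i. G (e i) v = 0"
  shows "v = (\<lambda>f. 0)"
proof (rule metric_nondegenerate[OF p assms(1)])
  fix u assume u: "u \<in> T"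
  have "G u v = (\<Sum>i\<in>UNIV. components c u $ i * G (e i) v)"
    by (rule linear_functional_expand[OF _ u]) (simp add: G_linear assms(1))
  then show "G v u = 0"
    by (simp add: assms G_sym[OF assms(1) u])
qed

text \<open>Nondegeneracy says that the Gram matrix has trivial kernel, hence is invertible, and the
  inverse of a symmetric matrix is symmetric.\<close>

lemma gram_inverse:
  obtains B where "gram ** B = mat 1" "transpose B = B"
proof -
  have "w = 0" if "gram *v w = 0" for w
  proof -
    let ?v = "coord_vec M c p w"
    have v: "?v \<in> T" and w: "components c ?v = w"
      using coord_vec_tangent components_coord_vec chart_at[OF p] by blast+
    have "?v = (\<lambda>f. 0)"
      by (rule metric_zeroI[OF v]) (simp add: metric_gram[OF v] w that)
    then have "components c ?v = 0"
      by (simp add: components_def vec_eq_iff)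
    then show ?thesis by (simp add: w)
  qed
  then obtain B where B: "B ** gram = mat 1"
    using matrix_left_invertible_ker by metis
  then have B': "gram ** B = mat 1"
    by (simp add: matrix_left_right_inverse)
  have "gram ** transpose B = transpose (B ** gram)"
    by (simp add: matrix_transpose_mul gram_symmetric)
  then have "gram ** transpose B = mat 1"
    by (simp add: B)
  \<comment> \<open>The left inverse \<open>B\<close> and the right inverse \<open>transpose B\<close> coincide.\<close>
  then have "B ** (gram ** transpose B) = B"
    by simp
  then have "transpose B = B"
    by (simp add: matrix_mul_assoc B)
  with B' show ?thesis using that by blast
qed

text \<open>Solve for the components with the inverse Gram matrix. Existence and uniqueness are what the
  Ricci operator, a definite description, needs in order to be meaningful.\<close>

lemma riesz:
  assumes lin: "\<And>u v a b. u \<in> T \<Longrightarrow> v \<in> T \<Longrightarrow> \<psi> (\<lambda>f. a * u f + b * v f) = a * \<psi> u + b * \<psi> v"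
  shows "\<exists>!q. q \<in> T \<and> (\<forall>y\<in>T. G q y = \<psi> y)"
proof -
  obtain B where B: "gram ** B = mat 1" by (rule gram_inverse)
  define q where "q = coord_vec M c p (B *v (\<chi> i. \<psi> (e i)))"
  have q: "q \<in> T"
    unfolding q_def by (rule coord_vec_tangent[OF chart_at[OF p]])
  have "components c q = B *v (\<chi> i. \<psi> (e i))"
    unfolding q_def by (rule components_coord_vec[OF chart_at[OF p]])
  then have "gram *v components c q = (\<chi> i. \<psi> (e i))"
    by (simp add: matrix_vector_mul_assoc B)
  then have qe: "G (e i) q = \<psi> (e i)" for i
    by (simp add: metric_gram[OF q])
  have "G y q = \<psi> y" if y: "y \<in> T" for y
  proof -
    have "G y q = (\<Sum>i\<in>UNIV. components c y $ i * G (e i) q)"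
      by (rule linear_functional_expand[OF _ y]) (simp add: G_linear q)
    also have "\<dots> = (\<Sum>i\<in>UNIV. components c y $ i * \<psi> (e i))"
      by (simp only: qe)
    also have "\<dots> = \<psi> y"
      by (rule linear_functional_expand[symmetric, OF _ y]) (rule lin)
    finally show ?thesis .
  qed
  then have rep: "G q y = \<psi> y" if "y \<in> T" for y
    using that G_sym[OF q that] by simp
  show ?thesis
  proof (rule ex1I)
    show "q \<in> T \<and> (\<forall>y\<in>T. G q y = \<psi> y)"
      using q rep by blast
    show "q' = q" if "q' \<in> T \<and> (\<forall>y\<in>T. G q' y = \<psi> y)" for q'
      using that q rep by (intro G_eqI) auto
  qed
qed

text \<open>The matrix of \<open>F\<close> times the Gram matrix is skew, so the trace is that of a skew matrix
  times the symmetric inverse Gram matrix, and such a trace is its own negative.\<close>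

lemma trace_skew:
  assumes F: "\<And>u. u \<in> T \<Longrightarrow> F u \<in> T" and skew: "\<And>u v. u \<in> T \<Longrightarrow> v \<in> T \<Longrightarrow> G (F u) v = - G (F v) u"
  shows "tangent_trace M p F = 0"
proof -
  obtain B where B: "gram ** B = mat 1" "transpose B = B" by (rule gram_inverse)
  define A :: "real^'n^'n" where "A = (\<chi> i j. components c (F (e i)) $ j)"
  define K where "K = A ** gram"
  have K_eq: "K $ i $ j = G (F (e i)) (e j)" for i j
    using metric_gram[OF F[OF e_tangent], of j i] G_sym[OF e_tangent F[OF e_tangent], of j i]
    by (simp add: K_def A_def gram_def matrix_matrix_mult_def matrix_vector_mult_def mult.commute
        G_sym[OF e_tangent e_tangent])
  have K: "K $ i $ j = - K $ j $ i" for i j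
    unfolding K_eq by (rule skew[OF e_tangent e_tangent])
  have Bs: "B $ i $ j = B $ j $ i" for i j
    using B(2) by (metis transpose_def vec_lambda_beta)
  \<comment> \<open>Cancelling the Gram matrix recovers the matrix of \<open>F\<close>.\<close>
  have "K ** B = A"
    by (simp add: K_def matrix_mul_assoc[symmetric] B)
  then have tr: "tangent_trace M p F = (\<Sum>i\<in>UNIV. \<Sum>j\<in>UNIV. K $ i $ j * B $ j $ i)"
    by (simp add: tangent_trace_def Let_def matrix_matrix_mult_def A_def vec_eq_iff)
  also have "\<dots> = (\<Sum>i\<in>UNIV. \<Sum>j\<in>UNIV. K $ j $ i * B $ i $ j)"
    by (rule sum.swap)
  also have "\<dots> = (\<Sum>i\<in>UNIV. \<Sum>j\<in>UNIV. - (K $ i $ j * B $ j $ i))"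
    by (intro sum.cong refl) (subst K, simp add: Bs)
  also have "\<dots> = - tangent_trace M p F"
    by (simp add: tr sum_negf)
  finally show ?thesis by simp
qed

section \<open>The curvature tensor at a point\<close>

lemmas ext_smooth = extension_smooth[OF p]
lemmas chart_open = chart_openin[OF chart_at(1)[OF p]] chart_at(2)[OF p]

lemma R_tangent: "R x y z \<in> T"
  unfolding curvature_def by (intro curvature_vfield_tangent[OF chart_open] ext_smooth)

lemma R_swap: "R y x z f = - R x y z f"
  unfolding curvature_def by (intro curvature_vfield_swap[OF chart_open] ext_smooth)

lemma R_bianchi: "R x y z f + R y z x f + R z x y f = 0"
  unfolding curvature_def by (intro curvature_vfield_bianchi[OF chart_open] ext_smooth)

lemma R_skew: "z \<in> T \<Longrightarrow> v \<in> T \<Longrightarrow> G (R x y z) v = - G (R x y v) z"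
  using curvature_vfield_skew[OF chart_open ext_smooth ext_smooth ext_smooth ext_smooth, of x y z v]
  by (simp add: curvature_def extension_value[OF p])

lemma R_pair:
  assumes "x \<in> T" "y \<in> T" "z \<in> T" "v \<in> T"
  shows "G (R x y z) v = G (R z v x) y"
proof (rule pair_symmetry[where R = "\<lambda>x y z v. G (R x y z) v" and T = T, OF _ _ _ assms])
  fix x y z v assume "x \<in> T" "y \<in> T" "z \<in> T" and v: "v \<in> T"
  have "R y x z = (\<lambda>f. -1 * R x y z f)"
    by (rule ext) (simp add: R_swap[of y x])
  then show "G (R y x z) v = - G (R x y z) v"
    using G_linear(3)[OF R_tangent v, of "-1" x y z] by simp
  have "(\<lambda>f. R x y z f + R y z x f + R z x y f) = (\<lambda>f. 0 * R x y z f)"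
    by (rule ext) (simp add: R_bianchi)
  then have "G (\<lambda>f. R x y z f + R y z x f + R z x y f) v = 0"
    using G_linear(3)[OF R_tangent v, of 0 x y z] by simp
  then show "G (R x y z) v + G (R y z x) v + G (R z x y) v = 0"
    by (simp add: G_linear R_tangent v T_closed)
qed (rule R_skew)

text \<open>Linearity is read off from the metric: by skewness, pairing \<open>R(x, y)z\<close> with \<open>v\<close> is a
  pairing of \<open>z\<close> with a fixed vector.\<close>

lemma R_linear:
  assumes "z \<in> T" "z' \<in> T"
  shows "R x y (\<lambda>f. a * z f + b * z' f) = (\<lambda>f. a * R x y z f + b * R x y z' f)"
proof (rule G_eqI)
  fix v assume v: "v \<in> T"
  let ?z = "\<lambda>f. a * z f + b * z' f"
  have z: "?z \<in> T" using assms by (rule tangent_lincomb)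
  have "G (R x y ?z) v = - G ?z (R x y v)"
    using R_skew[OF z v] G_sym[OF z R_tangent] by simp
  also have "\<dots> = a * G (R x y z) v + b * G (R x y z') v"
    using R_skew[OF assms(1) v] R_skew[OF assms(2) v] G_sym[OF assms(1) R_tangent]
      G_sym[OF assms(2) R_tangent] by (simp add: G_linear assms R_tangent)
  also have "\<dots> = G (\<lambda>f. a * R x y z f + b * R x y z' f) v"
    by (simp add: G_linear R_tangent v)
  finally show "G (R x y ?z) v = G (\<lambda>f. a * R x y z f + b * R x y z' f) v" .
qed (intro R_tangent tangent_lincomb)+

lemma ricci_eq: "S y z = (\<Sum>i\<in>UNIV. components c (R (e i) y z) $ i)"
  by (simp add: ricci_def tangent_trace_def Let_def)

lemma ricci_linear:
  "z \<in> T \<Longrightarrow> z' \<in> T \<Longrightarrow> S y (\<lambda>f. a * z f + b * z' f) = a * S y z + b * S y z'"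
  by (simp add: ricci_eq R_linear components_lincomb sum.distrib sum_distrib_left)

text \<open>By the cyclic identity the difference is, up to sign, the trace of \<open>R(y, z)\<close>, which is
  skew with respect to the metric.\<close>

lemma ricci_sym: "S y z = S z y"
proof -
  have "tangent_trace M p (R y z) = 0"
    by (rule trace_skew) (auto intro: R_tangent R_skew)
  moreover have "components c (R x y z) $ i - components c (R x z y) $ i
      = - components c (R y z x) $ i" for x i
    using R_bianchi[of x y z "\<lambda>q. snd c q $ i"] R_swap[of z x y "\<lambda>q. snd c q $ i"]
    by (simp add: components_def)
  then have "S y z - S z y = - tangent_trace M p (R y z)"
    by (simp add: ricci_eq tangent_trace_def Let_def flip: sum_subtractf sum_negf)
  ultimately show ?thesis by simp
qed

lemma ricci_op: "Q x \<in> T" "y \<in> T \<Longrightarrow> G (Q x) y = S x y"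
proof -
  have "\<exists>!q. q \<in> T \<and> (\<forall>y\<in>T. G q y = S x y)"
    by (rule riesz) (rule ricci_linear)
  from theI'[OF this] show "Q x \<in> T" "y \<in> T \<Longrightarrow> G (Q x) y = S x y"
    unfolding ricci_op_def by blast+
qed

section \<open>The \<open>\<xi>\<close>-component of the pseudosymmetry condition\<close>

lemma T_tensor_tangent:
  assumes "u \<in> T" "v \<in> T" "w \<in> T"
  shows "T_tensor M D a p u v w \<in> T"
  unfolding T_tensor_def Let_def
  by (intro tangent_add tangent_diff tangent_scale R_tangent ricci_op(1) assms)

lemma T_tensor_metric:
  assumes "u \<in> T" "v \<in> T" "w \<in> T" "x \<in> T"
  shows "G (T_tensor M D a p u v w) x
    = a 0 * G (R u v w) x + a 1 * S v w * G u x + a 2 * S u w * G v x + a 3 * S u v * G w x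
      + a 4 * G v w * S u x + a 5 * G u w * S v x + a 6 * G u v * S w x
      + a 7 * scalar_curvature M D p * (G v w * G u x - G u w * G v x)"
  unfolding T_tensor_def Let_def
  by (simp add: metric_add[OF p] metric_diff[OF p] metric_scale[OF p] tangent_add tangent_diff
      tangent_scale R_tangent ricci_op assms)

end

locale nullity_point = sr_mfd_point M D p
  for M :: "('m, 'n::finite, 'z) sr_manifold_scheme"
    and D :: "'m vfield \<Rightarrow> 'm vfield \<Rightarrow> 'm vfield"
    and p :: 'm +
  fixes k \<epsilon> :: real and \<xi> :: "'m tvec"
  assumes nullity: "\<xi> \<in> nullity_distribution M D k p"
    and norm_xi: "G \<xi> \<xi> = \<epsilon>"
begin

lemma xi: "\<xi> \<in> T"
  using nullity by (simp add: nullity_distribution_def)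

lemma R_xi: "x \<in> T \<Longrightarrow> y \<in> T \<Longrightarrow> R x y \<xi> = (\<lambda>f. k * (G y \<xi> * x f - G x \<xi> * y f))"
  using nullity by (simp add: nullity_distribution_def)

lemma R_metric_xi:
  assumes "x \<in> T" "y \<in> T" "z \<in> T"
  shows "G (R x y z) \<xi> = k * (G x \<xi> * G y z - G y \<xi> * G x z)"
  using R_skew[OF assms(3) xi, of x y]
  by (simp add: R_xi assms metric_diff[OF p] metric_scale[OF p] tangent_diff tangent_scale)
    (simp add: algebra_simps)

text \<open>Pair symmetry moves \<open>\<xi>\<close> from the first to the third position, where the nullity condition
  applies. This is the identity that makes \<open>R(\<xi>, X)\<close> proportional to \<open>\<xi> \<and> X\<close>.\<close>

lemma R_xi_left:
  assumes "x \<in> T" "y \<in> T"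
  shows "R \<xi> x y = (\<lambda>f. k * wedge M p \<xi> x y f)"
proof (rule G_eqI)
  show "G (R \<xi> x y) v = G (\<lambda>f. k * wedge M p \<xi> x y f) v" if v: "v \<in> T" for v
  proof -
    have "G (R \<xi> x y) v = G (R y v \<xi>) x"
      by (rule R_pair[OF xi assms v])
    then show ?thesis
      using G_sym[OF assms] G_sym[OF assms(1) v] G_sym[OF xi v] G_sym[OF xi assms(2)]
      by (simp add: R_xi wedge_def assms v xi metric_diff[OF p] metric_scale[OF p]
          tangent_diff tangent_scale)
  qed
qed (auto simp: wedge_def intro!: R_tangent tangent_scale tangent_diff xi assms)

text \<open>The trace of \<open>x \<mapsto> k (g(y, \<xi>) x - g(x, \<xi>) y)\<close>: the first part contributes the dimension,
  the second is an endomorphism of rank at most one with trace \<open>g(y, \<xi>)\<close>.\<close>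

lemma ricci_xi:
  assumes y: "y \<in> T"
  shows "S y \<xi> = k * (real CARD('n) - 1) * G y \<xi>"
proof -
  have "components c (R (e i) y \<xi>) $ i = k * (G y \<xi> - components c y $ i * G (e i) \<xi>)" for i
  proof -
    have "components c (e i) $ i = 1"
      by (simp add: components_coord_vec[OF chart_at[OF p]])
    then show ?thesis
      by (simp add: R_xi e_tangent y components_def)
  qed
  then have "S y \<xi> = k * (real CARD('n) * G y \<xi> - (\<Sum>i\<in>UNIV. components c y $ i * G (e i) \<xi>))"
    by (simp add: ricci_eq sum_distrib_left[symmetric] sum_subtractf)
  also have "(\<Sum>i\<in>UNIV. components c y $ i * G (e i) \<xi>) = G y \<xi>"
    by (rule linear_functional_expand[symmetric, OF _ y]) (simp add: metric_lincomb[OF p] xi)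
  finally show ?thesis by (simp add: algebra_simps)
qed

text \<open>The pairing of \<open>((\<xi> \<and> x) \<cdot> T\<^sub>a)(u, v) w\<close> with \<open>\<xi>\<close>, evaluated by means of the nullity
  condition; the coefficient \<open>k (n - 1)\<close> is the Ricci eigenvalue of \<open>\<xi>\<close>.\<close>

definition xi_contraction ::
    "(nat \<Rightarrow> real) \<Rightarrow> 'm tvec \<Rightarrow> 'm tvec \<Rightarrow> 'm tvec \<Rightarrow> 'm tvec \<Rightarrow> real"
  where "xi_contraction a u v w x =
      \<epsilon> * a 0 * G (R u v w) x + \<epsilon> * a 4 * S x u * G v w
      + \<epsilon> * a 5 * S x v * G u w + \<epsilon> * a 6 * S x w * G u v
      - \<epsilon> * k * (real CARD('n) - 1) * a 6 * G u v * G x w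
      - k * (real CARD('n) - 1) * (a 2 + a 3) * G x u * G v \<xi> * G w \<xi>
      - k * (real CARD('n) - 1) * (a 1 + a 3) * G x v * G u \<xi> * G w \<xi>
      - k * (real CARD('n) - 1) * (a 1 + a 2) * G x w * G u \<xi> * G v \<xi>
      + (a 2 + a 3) * S x u * G v \<xi> * G w \<xi>
      + (a 1 + a 3) * S x v * G u \<xi> * G w \<xi>
      + (a 1 + a 2) * S x w * G u \<xi> * G v \<xi>
      - \<epsilon> * (- k * a 0 + k * (real CARD('n) - 1) * a 5) * G u w * G x v
      - \<epsilon> * (k * a 0 + k * (real CARD('n) - 1) * a 4) * G v w * G x u"

text \<open>After pairing with \<open>\<xi>\<close>, every term of \<open>T\<^sub>a\<close> is expressed by the metric and the Ricci
  tensor, except \<open>a\<^sub>0 R(u, v, w, x)\<close>; the terms with \<open>g(x, \<xi>)\<close> and the scalar curvature terms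
  cancel. The factor \<open>b\<close> allows both \<open>R(\<xi>, x)\<close>, with \<open>b = k\<close>, and \<open>\<xi> \<and> x\<close> itself. Only values
  of \<open>F\<close> on tangent vectors are prescribed.\<close>

lemma wedge_action_contracted:
  assumes F: "\<And>y. y \<in> T \<Longrightarrow> F y = (\<lambda>f. b * wedge M p \<xi> x y f)"
    and T: "u \<in> T" "v \<in> T" "w \<in> T" "x \<in> T"
  shows "G (endo_act F (T_tensor M D a p) u v w) \<xi> = b * xi_contraction a u v w x"
proof -
  define \<kappa> where "\<kappa> = k * (real CARD('n) - 1)"
  define t where "t = T_tensor M D a p"
  have t_T: "t u v w \<in> T" if "u \<in> T" "v \<in> T" "w \<in> T" for u v w
    unfolding t_def using that by (rule T_tensor_tangent)
  have Fy: "F y = (\<lambda>f. (b * G x y) * \<xi> f + (- b * G \<xi> y) * x f)" if "y \<in> T" for y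
    by (rule ext) (simp add: F[OF that] wedge_def algebra_simps)
  have F_T: "F y \<in> T" if "y \<in> T" for y
    unfolding Fy[OF that] by (rule tangent_lincomb[OF xi T(4)])
  have GF: "G (F y) z = b * (G x y * G \<xi> z - G y \<xi> * G x z)" if "y \<in> T" "z \<in> T" for y z
    unfolding Fy[OF that(1)] metric_lincomb[OF p xi T(4) that(2)]
    by (simp add: G_sym[OF xi that(1)] algebra_simps)
  have SF: "S z (F y) = b * (G x y * (\<kappa> * G z \<xi>) - G y \<xi> * S z x)" if "y \<in> T" "z \<in> T" for y z
    unfolding Fy[OF that(1)] ricci_linear[OF xi T(4)] ricci_xi[OF that(2)] \<kappa>_def
    by (simp add: G_sym[OF xi that(1)] algebra_simps)
  have t_xi: "G (t u v w) \<xi> = a 0 * (k * (G u \<xi> * G v w - G v \<xi> * G u w))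
      + a 1 * S v w * G u \<xi> + a 2 * S u w * G v \<xi> + a 3 * S u v * G w \<xi>
      + a 4 * G v w * (\<kappa> * G u \<xi>) + a 5 * G u w * (\<kappa> * G v \<xi>) + a 6 * G u v * (\<kappa> * G w \<xi>)
      + a 7 * scalar_curvature M D p * (G v w * G u \<xi> - G u w * G v \<xi>)"
    if "u \<in> T" "v \<in> T" "w \<in> T" for u v w
    unfolding t_def T_tensor_metric[OF that xi] R_metric_xi[OF that] \<kappa>_def
    by (simp only: ricci_xi that)
  have t_x: "G (t u v w) x = a 0 * G (R u v w) x + a 1 * S v w * G u x + a 2 * S u w * G v x
      + a 3 * S u v * G w x + a 4 * G v w * S u x + a 5 * G u w * S v x + a 6 * G u v * S w x
      + a 7 * scalar_curvature M D p * (G v w * G u x - G u w * G v x)"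
    unfolding t_def by (rule T_tensor_metric[OF T])
  have "G (endo_act F t u v w) \<xi>
      = G (F (t u v w)) \<xi> - G (t (F u) v w) \<xi> - G (t u (F v) w) \<xi> - G (t u v (F w)) \<xi>"
    unfolding endo_act_def
    by (simp add: metric_diff[OF p] tangent_diff F_T t_T T xi)
  also have "G (F (t u v w)) \<xi> = b * (G (t u v w) x * \<epsilon> - G (t u v w) \<xi> * G x \<xi>)"
    using GF[OF t_T[OF T(1-3)] xi] G_sym[OF t_T[OF T(1-3)] T(4)] by (simp add: norm_xi)
  finally have expand: "G (endo_act F t u v w) \<xi>
      = b * (G (t u v w) x * \<epsilon> - G (t u v w) \<xi> * G x \<xi>)
        - G (t (F u) v w) \<xi> - G (t u (F v) w) \<xi> - G (t u v (F w)) \<xi>" .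
  note sym = G_sym[OF xi T(1)] G_sym[OF xi T(2)] G_sym[OF xi T(3)] G_sym[OF xi T(4)]
    G_sym[OF T(2,1)] G_sym[OF T(3,1)] G_sym[OF T(3,2)]
    G_sym[OF T(1,4)] G_sym[OF T(2,4)] G_sym[OF T(3,4)]
  have GF2: "G z (F y) = b * (G x y * G z \<xi> - G y \<xi> * G z x)" if "y \<in> T" "z \<in> T" for y z
    using GF[OF that] G_sym[OF that(2) F_T[OF that(1)]] G_sym[OF that(2) xi] G_sym[OF that(2) T(4)]
    by simp
  have SF2: "S (F y) z = b * (G x y * (\<kappa> * G z \<xi>) - G y \<xi> * S x z)" if "y \<in> T" "z \<in> T" for y z
    using SF[OF that] ricci_sym[of z "F y"] ricci_sym[of z x] by simp
  show ?thesis
    unfolding xi_contraction_def t_def[symmetric] expand t_x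
      t_xi[OF T(1-3)] t_xi[OF F_T[OF T(1)] T(2,3)] t_xi[OF T(1) F_T[OF T(2)] T(3)]
      t_xi[OF T(1,2) F_T[OF T(3)]]
      GF[OF T(1,2)] GF[OF T(1,3)] GF[OF T(1) xi] GF[OF T(2,3)] GF[OF T(2) xi] GF[OF T(3) xi]
      GF2[OF T(2,1)] GF2[OF T(3,1)] GF2[OF T(3,2)]
      SF[OF T(2,1)] SF[OF T(3,1)] SF[OF T(3,2)] SF2[OF T(1,2)] SF2[OF T(1,3)] SF2[OF T(2,3)]
      norm_xi sym ricci_sym[of u x] ricci_sym[of v x] ricci_sym[of w x] \<kappa>_def
    by (simp add: algebra_simps)
qed

end

theorem theorem4p4:
  fixes M :: "('m, 'n::finite) sr_manifold"
    and D :: "'m vfield \<Rightarrow> 'm vfield \<Rightarrow> 'm vfield"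
    and k \<epsilon> :: real and \<xi> :: "'m vfield"
    and a :: "nat \<Rightarrow> real" and L :: "'m \<Rightarrow> real"
    and U V W X :: "'m vfield" and p :: 'm
  assumes "Nk_semi_riemannian M D k \<xi> \<epsilon>"
    and "T_pseudosymmetric M D a L"
    and "smooth_vfield M (U_set M D a) U"
    and "smooth_vfield M (U_set M D a) V"
    and "smooth_vfield M (U_set M D a) W"
    and "smooth_vfield M (U_set M D a) X"
    and "p \<in> U_set M D a"
  shows
    "let n = real CARD('n);
         g = (\<lambda>A B. metric_tensor M p (A p) (B p));
         S = (\<lambda>A B. ricci M D p (A p) (B p));
         R = (\<lambda>A B C E. curvature4 M D p (A p) (B p) (C p) (E p));
         \<eta> = (\<lambda>A. \<epsilon> * g A \<xi>)
     in
       \<epsilon> * a 0 * k * R U V W X + \<epsilon> * k * a 4 * S X U * g V W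
       + \<epsilon> * k * a 5 * S X V * g U W + \<epsilon> * k * a 6 * S X W * g U V
       - \<epsilon> * k^2 * (n - 1) * a 6 * g X W * g U V
       - \<epsilon> * k * (k * a 0 + k * (n - 1) * a 4) * g V W * g X U
       - \<epsilon> * k * (- k * a 0 + k * (n - 1) * a 5) * g U W * g X V
       - k^2 * (n - 1) * (a 2 + a 3) * g X U * \<eta> V * \<eta> W
       - k^2 * (n - 1) * (a 1 + a 3) * g X V * \<eta> U * \<eta> W
       - k^2 * (n - 1) * (a 1 + a 2) * g X W * \<eta> U * \<eta> V
       + k * (a 2 + a 3) * S X U * \<eta> V * \<eta> W
       + k * (a 1 + a 3) * S X V * \<eta> U * \<eta> W
       + k * (a 1 + a 2) * S X W * \<eta> U * \<eta> V
       =
       L p *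
        (\<epsilon> * a 0 * R U V W X + \<epsilon> * a 4 * S X U * g V W
         + \<epsilon> * a 5 * S X V * g U W + \<epsilon> * a 6 * S X W * g U V
         - \<epsilon> * k * (n - 1) * a 6 * g U V * g X W
         - k * (n - 1) * (a 2 + a 3) * g X U * \<eta> V * \<eta> W
         - k * (n - 1) * (a 1 + a 3) * g X V * \<eta> U * \<eta> W
         - k * (n - 1) * (a 1 + a 2) * g X W * \<eta> U * \<eta> V
         + (a 2 + a 3) * S X U * \<eta> V * \<eta> W
         + (a 1 + a 3) * S X V * \<eta> U * \<eta> W
         + (a 1 + a 2) * S X W * \<eta> U * \<eta> V
         - \<epsilon> * (- k * a 0 + k * (n - 1) * a 5) * g U W * g X V
         - \<epsilon> * (k * a 0 + k * (n - 1) * a 4) * g V W * g X U)"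
proof -
  have p: "p \<in> topspace (top_of M)"
    using assms(7) by (simp add: U_set_def)
  interpret nullity_point M D p k \<epsilon> "\<xi> p"
    using assms(1) p by unfold_locales (auto simp: Nk_semi_riemannian_def)
  have \<epsilon>: "\<epsilon> * \<epsilon> = 1"
    using assms(1) by (auto simp: Nk_semi_riemannian_def)
  note T = vfield_tangent[OF assms(3,7)] vfield_tangent[OF assms(4,7)]
    vfield_tangent[OF assms(5,7)] vfield_tangent[OF assms(6,7)]
  let ?t = "T_tensor M D a p" and ?w = "wedge M p (\<xi> p) (X p)"
  have w: "?w y \<in> T" if "y \<in> T" for y
    unfolding wedge_def by (intro tangent_diff tangent_scale xi T)
  have "endo_act ?w ?t (U p) (V p) (W p) \<in> T"
    unfolding endo_act_def by (intro tangent_diff w T_tensor_tangent T)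
  moreover have "endo_act (R (\<xi> p) (X p)) ?t (U p) (V p) (W p)
      = (\<lambda>f. L p * endo_act ?w ?t (U p) (V p) (W p) f)"
    using assms(2,7) T xi unfolding T_pseudosymmetric_def by blast
  ultimately have "G (endo_act (R (\<xi> p) (X p)) ?t (U p) (V p) (W p)) (\<xi> p)
      = L p * G (endo_act ?w ?t (U p) (V p) (W p)) (\<xi> p)"
    by (simp add: metric_scale[OF p] xi)
  moreover have "G (endo_act (R (\<xi> p) (X p)) ?t (U p) (V p) (W p)) (\<xi> p)
      = k * xi_contraction a (U p) (V p) (W p) (X p)"
    by (rule wedge_action_contracted[OF R_xi_left[OF T(4)] T])
  moreover have "G (endo_act ?w ?t (U p) (V p) (W p)) (\<xi> p)
      = 1 * xi_contraction a (U p) (V p) (W p) (X p)"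
    by (rule wedge_action_contracted[OF _ T]) simp
  ultimately have main: "k * xi_contraction a (U p) (V p) (W p) (X p)
      = L p * xi_contraction a (U p) (V p) (W p) (X p)"
    by simp
  \<comment> \<open>Each term with \<open>\<eta>\<close> contains it twice, so the two factors \<open>\<epsilon>\<close> cancel.\<close>
  have \<eta>: "b * (\<epsilon> * y) * (\<epsilon> * z) = b * y * z" for b y z
    using \<epsilon> by (metis (no_types, lifting) mult.assoc mult.commute mult_1)
  show ?thesis
    unfolding Let_def curvature4_def \<eta>
    using main[unfolded xi_contraction_def] by (simp add: algebra_simps power2_eq_square)
qed

end
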